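(* Let $X$ be a continuous cocycle with values in $GL(n,\mathbb{R})$. If $X$ is $GL(n,\mathbb{C})$-reducible, then $X$ is $GL(n,\mathbb{R})$-reducible modulo $2$.
   Context: Let $\mathbb{T}^d=\mathbb{R}^d/\mathbb{Z}^d$ and, for an integer $N\ge 1$, $N\mathbb{T}^d=\mathbb{R}^d/(N\mathbb{Z})^d$; functions on $\mathbb{T}^d$ are also viewed as functions on $N\mathbb{T}^d$ through the canonical projection. Fix $\omega\in\mathbb{R}^d$ rationally independent, i.e. $\langle k,\omega\rangle\neq 0$ for all $k\in\mathbb{Z}^d\setminus\{0\}$. Let $G$ be a Lie subgroup of $GL(n,\mathbb{C})$ with Lie algebra $\mathcal{G}$. A $G$-valued continuous cocycle is the map $X:\mathbb{R}\times\mathbb{T}^d\to G$, $(t,\theta)\mapsto X^t(\theta)$, solving $\frac{d}{dt}X^t(\theta)=A(\theta+t\omega)X^t(\theta)$, $X^0(\theta)=Id$ for all $\theta$, for some continuous $A:\mathbb{T}^d\to\mathcal{G}$. It satisfies $X^{t+s}(\theta)=X^t(\theta+s\omega)X^s(\theta)$. For a Lie subgroup $G'$ of $GL(n,\mathbb{C})$ with Lie algebra $\mathcal{G}'$, a continuous cocycle $X$ with values in $G'$ is $G'$-reducible modulo $N$ if there exist a continuous $Z:N\mathbb{T}^d\to G'$ and $B\in\mathcal{G}'$ such that $X^t(\theta)=Z(\theta+t\omega)^{-1}e^{tB}Z(\theta)$ for all $t\in\mathbb{R}$ and all $\theta$ (in $N\mathbb{T}^d$). "$G'$-reducible" means $G'$-reducible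 modulo $1$. *)

theory Defs
  imports "HOL-Analysis.Analysis"
begin

definition integer_lattice :: "(real ^ 'd) set"
  where "integer_lattice = {k. \<forall>i. k $ i \<in> \<int>}"

definition rationally_independent :: "real ^ 'd \<Rightarrow> bool"
  where "rationally_independent \<omega> \<longleftrightarrow> (\<forall>k\<in>integer_lattice - {0}. k \<bullet> \<omega> \<noteq> 0)"

text \<open>Functions on the torus \<open>\<real>\<^sup>d / (N\<int>)\<^sup>d\<close> are represented by their lifts to \<open>\<real>\<^sup>d\<close>, i.e. by
  the \<open>(N\<int>)\<^sup>d\<close>-periodic functions; continuity on the torus is continuity of the lift, and
  pulling a function back along the projection of the \<open>N\<close>-fold torus to the torus leaves the
  lift unchanged.\<close>

definition torus_function :: "nat \<Rightarrow> (real ^ 'd \<Rightarrow> 'a) \<Rightarrow> bool"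
  where "torus_function N f \<longleftrightarrow> (\<forall>k\<in>integer_lattice. \<forall>\<theta>. f (\<theta> + real N *\<^sub>R k) = f \<theta>)"

text \<open>The product \<open>(*)\<close> on vectors and matrices is componentwise, so neither the library power
  \<open>(^)\<close> nor the library \<open>exp\<close> is the right notion for matrices.\<close>

definition matrix_exp :: "complex ^ 'n ^ 'n \<Rightarrow> complex ^ 'n ^ 'n"
  where "matrix_exp A = (\<Sum>k. (1 / fact k) *\<^sub>R (((**) A ^^ k) (mat 1)))"

definition GL_complex :: "(complex ^ 'n ^ 'n) set"
  where "GL_complex = {A. invertible A}"

definition GL_real :: "(complex ^ 'n ^ 'n) set"
  where "GL_real = {A. invertible A \<and> (\<forall>i j. A $ i $ j \<in> \<real>)}"

text \<open>The Lie algebra of a Lie subgroup \<open>G\<close> of \<open>GL(n,\<complex>)\<close>, as a set of matrices.\<close>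

definition lie_algebra :: "(complex ^ 'n ^ 'n) set \<Rightarrow> (complex ^ 'n ^ 'n) set"
  where "lie_algebra G = {B. \<forall>t::real. matrix_exp (t *\<^sub>R B) \<in> G}"

definition continuous_cocycle ::
    "real ^ 'd \<Rightarrow> (complex ^ 'n ^ 'n) set \<Rightarrow> (real \<Rightarrow> real ^ 'd \<Rightarrow> complex ^ 'n ^ 'n) \<Rightarrow> bool"
  where "continuous_cocycle \<omega> G X \<longleftrightarrow>
    (\<forall>t. torus_function 1 (X t)) \<and> (\<forall>t \<theta>. X t \<theta> \<in> G) \<and>
    (\<exists>A. torus_function 1 A \<and> continuous_on UNIV A \<and> (\<forall>\<theta>. A \<theta> \<in> lie_algebra G) \<and>
      (\<forall>\<theta>. X 0 \<theta> = mat 1 \<and>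
        (\<forall>t. ((\<lambda>s. X s \<theta>) has_vector_derivative A (\<theta> + t *\<^sub>R \<omega>) ** X t \<theta>) (at t))))"

definition reducible_modulo ::
    "real ^ 'd \<Rightarrow> (complex ^ 'n ^ 'n) set \<Rightarrow> nat \<Rightarrow>
      (real \<Rightarrow> real ^ 'd \<Rightarrow> complex ^ 'n ^ 'n) \<Rightarrow> bool"
  where "reducible_modulo \<omega> G N X \<longleftrightarrow>
    (\<exists>Z. \<exists>B\<in>lie_algebra G.
      torus_function N Z \<and> continuous_on UNIV Z \<and> (\<forall>\<theta>. Z \<theta> \<in> G) \<and>
      (\<forall>t \<theta>. X t \<theta> = matrix_inv (Z (\<theta> + t *\<^sub>R \<omega>)) ** matrix_exp (t *\<^sub>R B) ** Z \<theta>))"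

abbreviation reducible ::
    "real ^ 'd \<Rightarrow> (complex ^ 'n ^ 'n) set \<Rightarrow> (real \<Rightarrow> real ^ 'd \<Rightarrow> complex ^ 'n ^ 'n) \<Rightarrow> bool"
  where "reducible \<omega> G X \<equiv> reducible_modulo \<omega> G 1 X"

end

theory Submission
  imports Defs
    "HOL-Analysis.Kronecker_Approximation_Theorem"
    "HOL-Computational_Algebra.Fundamental_Theorem_Algebra"
begin

text \<open>
  Write \<open>X t \<theta> = Z(\<theta> + t\<omega>)\<^sup>-\<^sup>1 exp(tB) Z(\<theta>)\<close> with complex \<open>Z\<close> and \<open>B\<close>, and let \<open>mat_cnj\<close> denote
  entrywise complex mat_cnjugation. The matrix \<open>W = mat_cnj Z \<cdot> Z\<^sup>-\<^sup>1\<close> measures how far \<open>Z\<close> is from being real.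
  Since \<open>X\<close> is real, it satisfies \<open>W \<cdot> mat_cnj W = 1\<close> and
  \<open>W(\<theta> + t\<omega>) = exp(t mat_cnj B) W(\<theta>) exp(-tB)\<close>.

  Cut \<open>W\<close> into blocks by the spectral projections \<open>P z\<close> of \<open>B\<close> (lemma \<open>spectral_projections\<close>) on the
  right and their mat_cnjugates on the left. Along the flow a block is an exponential
  \<open>exp((cnj w - z)t)\<close> times a polynomial in \<open>t\<close>. A continuous function on the torus is bounded, which
  leaves no room for the polynomial (lemma \<open>bounded_flow_of_generalized_eigenvectors\<close>). Every entry of
  the block is thus an eigenfunction of the flow in direction \<open>\<omega>\<close>. By Kronecker's density theorem such
  a function vanishes or is a multiple of a single character \<open>exp(2\<pi>i\<langle>k,\<theta>\<rangle>)\<close>, with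
  \<open>cnj w - z = 2\<pi>i\<langle>k,\<omega>\<rangle>\<close> (lemma \<open>line_eigenfunction\<close>). Hence \<open>W\<close> is a trigonometric polynomial whose
  frequencies are dictated by resonances between the eigenvalues of \<open>B\<close> and their mat_cnjugates.

  These frequencies can be removed by multiplying \<open>Z\<close> from the left by
  \<open>\<Phi>(\<theta>) = \<Sum>z. exp(2\<pi>i\<langle>m z,\<theta>\<rangle>) P z\<close>, provided that \<open>m w + m z = k\<close> for each resonance. This can be
  solved symmetrically in \<open>w\<close> and \<open>z\<close> (lemma \<open>half_lattice_gauge\<close>), at the price of half-integral
  vectors \<open>m z\<close>: an eigenvalue resonant with its own mat_cnjugate by \<open>k\<close> has to be shifted by \<open>k/2\<close>.
  This is why the torus has to be doubled. The factor \<open>\<Phi>\<close> commutes with \<open>exp(tB)\<close> and changes only the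
  eigenvalues of \<open>B\<close>.

  For \<open>\<Phi> Z\<close> the matrix \<open>W\<close> has become a constant \<open>W\<^sub>0\<close> with \<open>W\<^sub>0 \<cdot> mat_cnj W\<^sub>0 = 1\<close>. Hilbert's
  Theorem 90 for \<open>GL(n)\<close> (lemma \<open>hilbert_90\<close>) gives \<open>W\<^sub>0 = (mat_cnj R)\<^sup>-\<^sup>1 R\<close> with a constant
  invertible \<open>R\<close>, and then \<open>R \<Phi> Z\<close> is real.
\<close>

section \<open>Complex matrices as a Banach algebra\<close>

text \<open>On vectors of vectors the product is componentwise. A copy of the type carries the matrix product
  and the operator norm instead, so that the theory of \<open>exp\<close> in Banach algebras applies to matrices.\<close>
typedef ('n::finite) cmat = "UNIV :: (complex ^ 'n ^ 'n) set"
  morphisms mat_of cmat_of ..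

setup_lifting type_definition_cmat

instantiation cmat :: (finite) ring_1
begin

lift_definition zero_cmat :: "'a cmat" is 0 .
lift_definition one_cmat :: "'a cmat" is "mat 1" .
lift_definition plus_cmat :: "'a cmat \<Rightarrow> 'a cmat \<Rightarrow> 'a cmat" is "(+)" .
lift_definition minus_cmat :: "'a cmat \<Rightarrow> 'a cmat \<Rightarrow> 'a cmat" is "(-)" .
lift_definition uminus_cmat :: "'a cmat \<Rightarrow> 'a cmat" is uminus .
lift_definition times_cmat :: "'a cmat \<Rightarrow> 'a cmat \<Rightarrow> 'a cmat" is "(**)" .

instance
proof
  fix A B C :: "'a cmat"
  show "A * B * C = A * (B * C)" by transfer (simp add: matrix_mul_assoc)
  show "(A + B) * C = A * C + B * C"
    by transfer (vector matrix_matrix_mult_def sum.distrib algebra_simps)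
  show "A * (B + C) = A * B + A * C" by transfer (rule matrix_add_ldistrib)
  show "(0::'a cmat) \<noteq> 1" by transfer (simp add: mat_def vec_eq_iff)
qed (transfer; simp)+

end

instantiation cmat :: (finite) real_algebra_1
begin

lift_definition scaleR_cmat :: "real \<Rightarrow> 'a cmat \<Rightarrow> 'a cmat" is "scaleR" .

instance
proof
  fix A B :: "'a cmat" and r s :: real
  show "r *\<^sub>R (A + B) = r *\<^sub>R A + r *\<^sub>R B" by transfer (rule scaleR_add_right)
  show "(r + s) *\<^sub>R A = r *\<^sub>R A + s *\<^sub>R A" by transfer (rule scaleR_add_left)
  show "r *\<^sub>R s *\<^sub>R A = (r * s) *\<^sub>R A" by transfer simp
  show "1 *\<^sub>R A = A" by transfer simp
  show "r *\<^sub>R A * B = r *\<^sub>R (A * B)"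
    by transfer (simp add: matrix_matrix_mult_def vec_eq_iff scaleR_sum_right)
  show "A * r *\<^sub>R B = r *\<^sub>R (A * B)"
    by transfer (simp add: matrix_matrix_mult_def vec_eq_iff scaleR_sum_right)
qed

end

lemma bounded_linear_matrix_vector: "bounded_linear ((*v) (A :: complex ^ 'n ^ 'm))"
  by simp

instantiation cmat :: (finite) real_normed_algebra_1
begin

lift_definition norm_cmat :: "'a cmat \<Rightarrow> real" is "\<lambda>A. onorm ((*v) A)" .

definition dist_cmat :: "'a cmat \<Rightarrow> 'a cmat \<Rightarrow> real"
  where "dist_cmat A B = norm (A - B)"

definition sgn_cmat :: "'a cmat \<Rightarrow> 'a cmat"
  where "sgn_cmat A = A /\<^sub>R norm A"

definition uniformity_cmat :: "('a cmat \<times> 'a cmat) filter"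
  where "uniformity_cmat = (INF e\<in>{0 <..}. principal {(A, B). dist A B < e})"

definition open_cmat :: "'a cmat set \<Rightarrow> bool"
  where "open_cmat U \<longleftrightarrow> (\<forall>A\<in>U. \<forall>\<^sub>F (A', B) in uniformity. A' = A \<longrightarrow> B \<in> U)"

instance
proof
  fix A B :: "'a cmat" and r :: real
  show "dist A B = norm (A - B)" by (rule dist_cmat_def)
  show "sgn A = A /\<^sub>R norm A" by (rule sgn_cmat_def)
  show "uniformity = (INF e\<in>{0 <..}. principal {(A :: 'a cmat, B). dist A B < e})"
    by (rule uniformity_cmat_def)
  show "open U = (\<forall>A\<in>U. \<forall>\<^sub>F (A', B) in uniformity. A' = A \<longrightarrow> B \<in> U)" for U :: "'a cmat set"
    by (rule open_cmat_def)
  show "norm A = 0 \<longleftrightarrow> A = 0"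
    by transfer (simp add: onorm_eq_0 matrix_eq)
  show "norm (A + B) \<le> norm A + norm B"
  proof transfer
    fix A B :: "complex ^ 'a ^ 'a"
    have "(*v) (A + B) = (\<lambda>x. A *v x + B *v x)" by (simp add: fun_eq_iff algebra_simps)
    then show "onorm ((*v) (A + B)) \<le> onorm ((*v) A) + onorm ((*v) B)"
      by (simp add: onorm_triangle)
  qed
  show "norm (r *\<^sub>R A) = \<bar>r\<bar> * norm A"
  proof transfer
    fix A :: "complex ^ 'a ^ 'a" and r :: real
    have "(*v) (r *\<^sub>R A) = (\<lambda>x. r *\<^sub>R (A *v x))"
      by (simp add: fun_eq_iff matrix_vector_mult_def vec_eq_iff scaleR_sum_right)
    then show "onorm ((*v) (r *\<^sub>R A)) = \<bar>r\<bar> * onorm ((*v) A)" by (simp add: onorm_scaleR)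
  qed
  show "norm (A * B) \<le> norm A * norm B"
  proof transfer
    fix A B :: "complex ^ 'a ^ 'a"
    have "(*v) (A ** B) = (*v) A \<circ> (*v) B" by (simp add: fun_eq_iff matrix_vector_mul_assoc)
    then show "onorm ((*v) (A ** B)) \<le> onorm ((*v) A) * onorm ((*v) B)"
      by (metis onorm_compose bounded_linear_matrix_vector)
  qed
  show "norm (1 :: 'a cmat) = 1"
  proof transfer
    have "(*v) (mat 1) = (\<lambda>x :: complex ^ 'a. x)" by (simp add: fun_eq_iff)
    then show "onorm ((*v) (mat 1 :: complex ^ 'a ^ 'a)) = 1" by (simp add: onorm_id)
  qed
qed

end

lemma norm_le_sum_norm_nth: "norm (x :: 'b::real_normed_vector ^ 'n) \<le> (\<Sum>i\<in>UNIV. norm (x $ i))"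
  unfolding norm_vec_def by (rule L2_set_le_sum) simp

text \<open>The operator norm and the entries control each other. This makes \<open>cmat\<close> complete and transfers
  continuity between \<open>cmat\<close> and the original type.\<close>
lemma norm_entry_le: "norm (mat_of A $ i $ j) \<le> norm A"
proof -
  have "mat_of A $ i $ j = (mat_of A *v axis j 1) $ i"
    by (simp add: matrix_vector_mult_def axis_def if_distrib[where f="\<lambda>x. _ * x"] cong: if_cong)
  also have "norm \<dots> \<le> norm (mat_of A *v axis j 1)" by (rule Finite_Cartesian_Product.norm_nth_le)
  also have "\<dots> \<le> norm A * norm (axis j (1::complex))"
    unfolding norm_cmat.rep_eq by (rule onorm) simp
  finally show ?thesis by (simp add: norm_axis_1)
qed

lemma norm_le_sum_norm_entry: "norm A \<le> (\<Sum>i\<in>UNIV. \<Sum>j\<in>UNIV. norm (mat_of A $ i $ j))"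
  unfolding norm_cmat.rep_eq
proof (rule onorm_bound)
  fix x
  have "norm (mat_of A *v x) \<le> (\<Sum>i\<in>UNIV. norm ((mat_of A *v x) $ i))"
    by (rule norm_le_sum_norm_nth)
  also have "\<dots> \<le> (\<Sum>i\<in>UNIV. \<Sum>j\<in>UNIV. norm (mat_of A $ i $ j) * norm x)"
  proof (rule sum_mono)
    fix i
    show "norm ((mat_of A *v x) $ i) \<le> (\<Sum>j\<in>UNIV. norm (mat_of A $ i $ j) * norm x)"
      unfolding matrix_vector_mult_def vec_lambda_beta
      by (rule sum_norm_le) (simp add: norm_mult mult_left_mono Finite_Cartesian_Product.norm_nth_le)
  qed
  finally show "norm (mat_of A *v x) \<le> (\<Sum>i\<in>UNIV. \<Sum>j\<in>UNIV. norm (mat_of A $ i $ j)) * norm x"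
    by (simp add: sum_distrib_right)
qed (simp add: sum_nonneg)

lemma bounded_linear_mat_of: "bounded_linear mat_of"
proof (rule bounded_linear_intro)
  fix A :: "'a cmat"
  have "norm (mat_of A) \<le> (\<Sum>i\<in>UNIV. \<Sum>j\<in>UNIV. norm (mat_of A $ i $ j))"
    by (intro order_trans[OF norm_le_sum_norm_nth] sum_mono norm_le_sum_norm_nth)
  also have "\<dots> \<le> (\<Sum>i::'a\<in>UNIV. \<Sum>j::'a\<in>UNIV. norm A)"
    by (intro sum_mono norm_entry_le)
  finally show "norm (mat_of A) \<le> norm A * (real CARD('a) * real CARD('a))"
    by (simp add: algebra_simps)
qed (simp_all add: plus_cmat.rep_eq scaleR_cmat.rep_eq)

lemma bounded_linear_cmat_of: "bounded_linear cmat_of"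
proof (rule bounded_linear_intro)
  fix A :: "complex ^ 'a ^ 'a"
  have "norm (cmat_of A) \<le> (\<Sum>i\<in>UNIV. \<Sum>j\<in>UNIV. norm (mat_of (cmat_of A) $ i $ j))"
    by (rule norm_le_sum_norm_entry)
  also have "\<dots> \<le> (\<Sum>i::'a\<in>UNIV. \<Sum>j::'a\<in>UNIV. norm A)"
    by (intro sum_mono) (metis UNIV_I cmat_of_inverse Finite_Cartesian_Product.norm_nth_le order_trans)
  finally show "norm (cmat_of A) \<le> norm A * (real CARD('a) * real CARD('a))"
    by (simp add: algebra_simps)
qed (simp_all add: plus_cmat.abs_eq scaleR_cmat.abs_eq)

instance cmat :: (finite) banach
proof
  fix X :: "nat \<Rightarrow> 'a cmat"
  assume "Cauchy X"
  then have "Cauchy (\<lambda>n. mat_of (X n))"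
    by (rule bounded_linear.Cauchy[OF bounded_linear_mat_of])
  then obtain L where "(\<lambda>n. mat_of (X n)) \<longlonglongrightarrow> L"
    using Cauchy_convergent convergentD by blast
  then have "(\<lambda>n. cmat_of (mat_of (X n))) \<longlonglongrightarrow> cmat_of L"
    by (rule bounded_linear.tendsto[OF bounded_linear_cmat_of])
  then show "convergent X" by (auto simp: mat_of_inverse convergent_def)
qed

text \<open>The same power series on both sides: the bounded linear \<open>mat_of\<close> can be moved inside the sum.\<close>
lemma matrix_exp_eq_exp: "matrix_exp A = mat_of (exp (cmat_of A))"
proof -
  have pow: "((**) A ^^ k) (mat 1) = mat_of (cmat_of A ^ k)" for k
    by (induction k) (simp_all add: one_cmat.rep_eq times_cmat.rep_eq cmat_of_inverse)
  have "(\<lambda>k. mat_of (cmat_of A ^ k /\<^sub>R fact k)) sums mat_of (exp (cmat_of A))"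
    by (rule bounded_linear.sums[OF bounded_linear_mat_of exp_converges])
  then show ?thesis
    unfolding matrix_exp_def pow
    by (intro sums_unique[symmetric]) (simp add: scaleR_cmat.rep_eq inverse_eq_divide)
qed

text \<open>The classes used for \<open>cmat\<close> describe real algebras. Complex scalars act through the central
  elements \<open>scalar_mat c\<close>.\<close>
lift_definition scalar_mat :: "complex \<Rightarrow> 'n::finite cmat" is mat .

lemma scalar_mat_hom [simp]:
  "scalar_mat 0 = 0" "scalar_mat 1 = 1"
  by (transfer; simp)+

lemma scalar_mat_add: "scalar_mat (a + b) = scalar_mat a + scalar_mat b"
  and scalar_mat_diff: "scalar_mat (a - b) = scalar_mat a - scalar_mat b"
  and scalar_mat_minus: "scalar_mat (- a) = - scalar_mat a"
  by (transfer; simp add: mat_def vec_eq_iff)+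

lemma scalar_mat_mult: "scalar_mat (a * b) = scalar_mat a * scalar_mat b"
  by transfer (simp add: matrix_matrix_mult_def mat_def vec_eq_iff if_distrib[where f="\<lambda>x. x *
      _"] cong: if_cong)

lemma scalar_mat_commute: "A * scalar_mat c = scalar_mat c * A"
  by transfer (simp add: matrix_matrix_mult_def mat_def vec_eq_iff mult.commute
      if_distrib[where f="\<lambda>x. x * _"] if_distrib[where f="\<lambda>x. _ * x"] cong: if_cong)

lemma scalar_mat_commute_left: "A * (scalar_mat c * B) = scalar_mat c * (A * B)"
  by (metis scalar_mat_commute mult.assoc)

lemma mat_of_scalar_mat_mult: "mat_of (scalar_mat c * A) $ i $ j = c * mat_of A $ i $ j"
  by transfer (simp add: matrix_matrix_mult_def mat_def if_distrib[where f="\<lambda>x. x * _"] cong: if_cong)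

lemma scaleR_eq_scalar_mat: "r *\<^sub>R A = scalar_mat (of_real r) * A"
proof -
  have "mat_of (r *\<^sub>R A) = mat_of (scalar_mat (of_real r) * A)"
    by (simp add: vec_eq_iff mat_of_scalar_mat_mult scaleR_cmat.rep_eq) (simp add: scaleR_conv_of_real)
  then show ?thesis by (simp add: mat_of_inject)
qed

lemma bounded_linear_scalar_mat: "bounded_linear scalar_mat"
proof -
  have "linear (scalar_mat :: complex \<Rightarrow> 'a cmat)"
    by (rule linearI) (simp_all add: scalar_mat_add scaleR_eq_scalar_mat scalar_mat_mult scaleR_conv_of_real)
  then show ?thesis by (simp add: linear_conv_bounded_linear)
qed

lift_definition mat_cnj :: "'n::finite cmat \<Rightarrow> 'n cmat" is "\<lambda>A. \<chi> i j. cnj (A $ i $ j)" .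

lemma mat_cnj_add: "mat_cnj (A + B) = mat_cnj A + mat_cnj B"
  and mat_cnj_diff: "mat_cnj (A - B) = mat_cnj A - mat_cnj B"
  and mat_cnj_mult: "mat_cnj (A * B) = mat_cnj A * mat_cnj B"
  and mat_cnj_0 [simp]: "mat_cnj 0 = 0"
  and mat_cnj_1 [simp]: "mat_cnj 1 = 1"
  and mat_cnj_mat_cnj [simp]: "mat_cnj (mat_cnj A) = A"
  and mat_cnj_scalar_mat: "mat_cnj (scalar_mat c) = scalar_mat (cnj c)"
  and mat_cnj_scaleR: "mat_cnj (r *\<^sub>R A) = r *\<^sub>R mat_cnj A"
  by (transfer; simp add: vec_eq_iff matrix_matrix_mult_def mat_def)+

lemma mat_cnj_power: "mat_cnj (A ^ n) = mat_cnj A ^ n"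
  by (induction n) (simp_all add: mat_cnj_mult)

lemma mat_cnj_sum: "mat_cnj (sum f S) = (\<Sum>x\<in>S. mat_cnj (f x))"
  by (induction S rule: infinite_finite_induct) (simp_all add: mat_cnj_add)

lemma bounded_linear_mat_cnj: "bounded_linear mat_cnj"
proof (rule bounded_linear_intro)
  fix A :: "'a cmat"
  have "norm (mat_cnj A) \<le> (\<Sum>i\<in>UNIV. \<Sum>j\<in>UNIV. norm (mat_of (mat_cnj A) $ i $ j))"
    by (rule norm_le_sum_norm_entry)
  also have "\<dots> \<le> (\<Sum>i::'a\<in>UNIV. \<Sum>j::'a\<in>UNIV. norm A)"
    by (intro sum_mono) (simp add: mat_cnj.rep_eq norm_entry_le)
  finally show "norm (mat_cnj A) \<le> norm A * (real CARD('a) * real CARD('a))"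
    by (simp add: algebra_simps)
qed (simp_all add: mat_cnj_add mat_cnj_scaleR)

lemma mat_cnj_exp: "mat_cnj (exp A) = exp (mat_cnj A)"
proof -
  have "(\<lambda>k. mat_cnj (A ^ k /\<^sub>R fact k)) sums mat_cnj (exp A)"
    by (rule bounded_linear.sums[OF bounded_linear_mat_cnj exp_converges])
  then have "(\<lambda>k. mat_cnj A ^ k /\<^sub>R fact k) sums mat_cnj (exp A)"
    by (simp add: mat_cnj_scaleR mat_cnj_power)
  then show ?thesis using exp_converges sums_unique2 by blast
qed

section \<open>Spectral projections of a matrix\<close>

lemma cmat_left_right_inverse: "A * B = 1 \<longleftrightarrow> B * A = (1 :: 'n::finite cmat)"
  by transfer (rule matrix_left_right_inverse)

lemma scalar_mat_cancel:
  assumes "c \<noteq> 0" and "scalar_mat c * A = 0" shows "A = 0"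
proof -
  have "A = scalar_mat (inverse c * c) * A" using assms(1) by simp
  also have "\<dots> = scalar_mat (inverse c) * (scalar_mat c * A)" by (simp add: scalar_mat_mult mult.assoc)
  finally show ?thesis using assms(2) by simp
qed

lemma shift_commute: "B * U = U * B \<Longrightarrow> (B - scalar_mat c) * U = U * (B - scalar_mat c)"
  by (simp add: algebra_simps scalar_mat_commute)

lemma shift_mult_commute:
  assumes "B * U = U * B"
  shows "B * ((B - scalar_mat c) * U) = (B - scalar_mat c) * U * B"
proof -
  have "B * (B - scalar_mat c) = (B - scalar_mat c) * B"
    by (simp add: algebra_simps scalar_mat_commute)
  then have "B * ((B - scalar_mat c) * U) = (B - scalar_mat c) * (B * U)" by (metis mult.assoc)
  then show ?thesis using assms by (simp add: mult.assoc)
qed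

text \<open>On the kernel of \<open>(B - \<mu>)\<^sup>m\<close> the matrix \<open>B - \<alpha>\<close> is \<open>\<mu> - \<alpha>\<close> plus a nilpotent one, hence
  invertible; the induction on \<open>m\<close> is the geometric series for the inverse. Commutation with \<open>B\<close> is
  recorded because the solutions are to become parts of spectral projections.\<close>
lemma solve_shifted:
  assumes "(B - scalar_mat \<mu>) ^ m * U = 0" and "B * U = U * B" and "\<mu> \<noteq> \<alpha>"
  shows "\<exists>V. (B - scalar_mat \<alpha>) * V = U \<and> (B - scalar_mat \<mu>) ^ m * V = 0 \<and> B * V = V * B"
  using assms(1,2)
proof (induction m arbitrary: U)
  case 0
  then show ?case by (intro exI[of _ 0]) simp
next
  case (Suc m)
  have "(B - scalar_mat \<mu>) ^ m * ((B - scalar_mat \<mu>) * U) = 0"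
    using Suc.prems(1) by (simp only: power_Suc2 mult.assoc)
  moreover have "B * ((B - scalar_mat \<mu>) * U) = (B - scalar_mat \<mu>) * U * B"
    by (rule shift_mult_commute[OF Suc.prems(2)])
  ultimately obtain U' where U': "(B - scalar_mat \<alpha>) * U' = (B - scalar_mat \<mu>) * U"
      "(B - scalar_mat \<mu>) ^ m * U' = 0" "B * U' = U' * B"
    using Suc.IH by blast
  define V where "V = scalar_mat (1 / (\<mu> - \<alpha>)) * (U - U')"
  have "(B - scalar_mat \<alpha>) * V =
      scalar_mat (1 / (\<mu> - \<alpha>)) * ((B - scalar_mat \<alpha>) * U - (B - scalar_mat \<alpha>) * U')"
    unfolding V_def by (simp only: scalar_mat_commute_left[of "B - scalar_mat \<alpha>"] right_diff_distrib)
  also have "(B - scalar_mat \<alpha>) * U - (B - scalar_mat \<alpha>) * U' = scalar_mat (\<mu> - \<alpha>) * U"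
    unfolding U'(1) by (simp add: scalar_mat_diff left_diff_distrib)
  also have "scalar_mat (1 / (\<mu> - \<alpha>)) * (scalar_mat (\<mu> - \<alpha>) * U) =
      scalar_mat (1 / (\<mu> - \<alpha>) * (\<mu> - \<alpha>)) * U"
    by (simp only: scalar_mat_mult mult.assoc)
  finally have 1: "(B - scalar_mat \<alpha>) * V = U" using assms(3) by simp
  have "(B - scalar_mat \<mu>) ^ Suc m * V = scalar_mat (1 / (\<mu> - \<alpha>)) *
      ((B - scalar_mat \<mu>) ^ Suc m * U - (B - scalar_mat \<mu>) * ((B - scalar_mat \<mu>) ^ m * U'))"
    unfolding V_def scalar_mat_commute_left right_diff_distrib[of "(B - scalar_mat \<mu>) ^ Suc m"]
    by (simp only: power_Suc mult.assoc)
  then have 2: "(B - scalar_mat \<mu>) ^ Suc m * V = 0" using Suc.prems(1) U'(2) by simp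
  have 3: "B * V = V * B"
    unfolding V_def using Suc.prems(2) U'(3)
    by (simp only: scalar_mat_commute_left[of B] mult.assoc right_diff_distrib left_diff_distrib)
  show ?case using 1 2 3 by blast
qed

text \<open>Generalized eigenspaces for different eigenvalues are independent: peeling off factors \<open>B - b\<close>
  reduces to a genuine eigenvector, on which \<open>(B - a)\<^sup>m\<close> acts as the nonzero scalar \<open>(b - a)\<^sup>m\<close>.\<close>
lemma coprime_powers_cancel:
  assumes "(B - scalar_mat a) ^ m * V = 0" and "(B - scalar_mat b) ^ k * V = 0" and "a \<noteq> b"
  shows "V = 0"
  using assms(1,2)
proof (induction k arbitrary: V)
  case (Suc k)
  have comm: "(B - scalar_mat a) ^ m * (B - scalar_mat b) =
      (B - scalar_mat b) * (B - scalar_mat a) ^ m"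
    by (rule power_commuting_commutes)
      (simp add: right_diff_distrib left_diff_distrib scalar_mat_commute[of B] mult.commute[of a b] flip: scalar_mat_mult)
  have "(B - scalar_mat b) * V = 0"
  proof (rule Suc.IH)
    show "(B - scalar_mat a) ^ m * ((B - scalar_mat b) * V) = 0"
      using Suc.prems(1) comm by (metis mult.assoc mult_zero_right)
    show "(B - scalar_mat b) ^ k * ((B - scalar_mat b) * V) = 0"
      using Suc.prems(2) by (simp only: power_Suc2 mult.assoc)
  qed
  then have eigen: "(B - scalar_mat a) * V = scalar_mat (b - a) * V"
    by (simp add: scalar_mat_diff algebra_simps)
  have "(B - scalar_mat a) ^ n * V = scalar_mat ((b - a) ^ n) * V" for n
  proof (induction n)
    case (Suc n)
    have "(B - scalar_mat a) ^ Suc n * V = (B - scalar_mat a) ^ n * (scalar_mat (b - a) * V)"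
      using eigen by (simp only: power_Suc2 mult.assoc)
    also have "\<dots> = scalar_mat (b - a) * ((B - scalar_mat a) ^ n * V)" by (rule scalar_mat_commute_left)
    finally show ?case using Suc.IH by (simp add: scalar_mat_mult mult.assoc)
  qed simp
  then have "scalar_mat ((b - a) ^ m) * V = 0" using Suc.prems(1) by simp
  then show ?case using assms(3) by (rule_tac scalar_mat_cancel) auto
qed simp

text \<open>The matrix \<open>p(B) V\<close>. The product with \<open>V\<close> is part of the definition, so that splitting off a linear
  factor of \<open>p\<close> just replaces \<open>V\<close>.\<close>
definition poly_act :: "'n::finite cmat \<Rightarrow> complex poly \<Rightarrow> 'n cmat \<Rightarrow> 'n cmat"
  where "poly_act B p V = (\<Sum>i\<le>degree p. scalar_mat (coeff p i) * (B ^ i * V))"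

lemma poly_act_eq_sum:
  "degree p \<le> n \<Longrightarrow> poly_act B p V = (\<Sum>i\<le>n. scalar_mat (coeff p i) * (B ^ i * V))"
  unfolding poly_act_def
  by (rule sum.mono_neutral_left) (auto simp: coeff_eq_0 not_le)

lemma poly_act_linear_factor: "poly_act B ([:- \<alpha>, 1:] * q) V = poly_act B q ((B - scalar_mat \<alpha>) * V)"
proof -
  define n where "n = Suc (degree q)"
  have deg: "degree ([:- \<alpha>, 1:] * q) \<le> n"
    using degree_mult_le[of "[:- \<alpha>, 1:]" q] by (simp add: n_def)
  have "poly_act B ([:- \<alpha>, 1:] * q) V =
      (\<Sum>i\<le>n. scalar_mat (coeff (pCons 0 q) i) * (B ^ i * V)) - (\<Sum>i\<le>n. scalar_mat (coeff q i) *
          (B ^ i * (scalar_mat \<alpha> * V)))"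
    unfolding poly_act_eq_sum[OF deg] sum_subtractf[symmetric]
  proof (intro sum.cong refl)
    fix i
    have "coeff ([:- \<alpha>, 1:] * q) i = coeff (pCons 0 q) i - coeff q i * \<alpha>" by simp
    then show "scalar_mat (coeff ([:- \<alpha>, 1:] * q) i) * (B ^ i * V) =
        scalar_mat (coeff (pCons 0 q) i) * (B ^ i * V) - scalar_mat (coeff q i) * (B ^ i *
            (scalar_mat \<alpha> * V))"
      by (simp only: scalar_mat_diff scalar_mat_mult scalar_mat_commute_left[of "B ^ i"] left_diff_distrib mult.assoc)
  qed
  also have "(\<Sum>i\<le>n. scalar_mat (coeff (pCons 0 q) i) * (B ^ i * V)) = poly_act B q (B * V)"
    by (simp only: n_def sum.atMost_Suc_shift poly_act_def coeff_pCons_0 coeff_pCons_Suc scalar_mat_hom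
        mult_zero_left add_0 power_Suc2 mult.assoc)
  also have "(\<Sum>i\<le>n. scalar_mat (coeff q i) * (B ^ i * (scalar_mat \<alpha> * V))) =
      poly_act B q (scalar_mat \<alpha> * V)"
    by (rule poly_act_eq_sum[symmetric]) (simp add: n_def)
  also have "poly_act B q (B * V) - poly_act B q (scalar_mat \<alpha> * V) =
      poly_act B q ((B - scalar_mat \<alpha>) * V)"
    unfolding poly_act_def sum_subtractf[symmetric]
      by (simp only: right_diff_distrib left_diff_distrib)
  finally show ?thesis .
qed

text \<open>The powers of \<open>B\<close> with exponent up to the real dimension of the space of matrices are linearly
  dependent, unless two of them coincide, and then their difference is the relation.\<close>
lemma annihilating_polynomial_exists:
  fixes B :: "'n::finite cmat"
  shows "\<exists>p. p \<noteq> 0 \<and> poly_act B p 1 = 0"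
proof -
  define N where "N = DIM(complex ^ 'n ^ 'n)"
  define f where "f i = mat_of (B ^ i)" for i
  have "\<exists>c :: nat \<Rightarrow> real. (\<exists>i\<le>N. c i \<noteq> 0) \<and> (\<Sum>i\<le>N. c i *\<^sub>R f i) = 0"
  proof (cases "inj_on f {..N}")
    case True
    then have "dependent (f ` {..N})"
      by (intro dependent_biggerset) (simp add: card_image N_def)
    then obtain u where u: "\<exists>v\<in>f ` {..N}. u v \<noteq> 0" "(\<Sum>v\<in>f ` {..N}. u v *\<^sub>R v) = 0"
      using dependent_finite[of "f ` {..N}"] by auto
    have "(\<Sum>i\<le>N. u (f i) *\<^sub>R f i) = 0" using u(2) by (simp add: sum.reindex[OF True])
    with u(1) show ?thesis by (intro exI[of _ "\<lambda>i. u (f i)"]) auto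
  next
    case False
    then obtain i j where ij: "i \<le> N" "j \<le> N" "i \<noteq> j" "f i = f j" by (auto simp: inj_on_def)
    define c :: "nat \<Rightarrow> real" where "c k = (if k = i then 1 else 0) - (if k = j then 1 else 0)" for k
    have "(\<Sum>k\<le>N. c k *\<^sub>R f k) = (\<Sum>k\<le>N. if k = i then f k else 0) - (\<Sum>k\<le>N. if k = j then f k else 0)"
      unfolding sum_subtractf[symmetric] by (intro sum.cong) (auto simp: c_def)
    also have "\<dots> = 0" using ij by (simp add: sum.delta)
    finally show ?thesis using ij by (intro exI[of _ c]) (auto simp: c_def)
  qed
  then obtain c :: "nat \<Rightarrow> real" and i where i: "i \<le> N" "c i \<noteq> 0" and c: "(\<Sum>i\<le>N. c i *\<^sub>R f i) = 0"
    by blast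
  define p where "p = (\<Sum>i\<le>N. monom (complex_of_real (c i)) i)"
  have coeff: "coeff p k = (if k \<le> N then of_real (c k) else 0)" for k
    by (simp add: p_def coeff_sum)
  have "p \<noteq> 0" using i coeff by (metis coeff_0 of_real_eq_0_iff)
  moreover have "degree p \<le> N" by (rule degree_le) (simp add: coeff)
  then have "poly_act B p 1 = (\<Sum>i\<le>N. c i *\<^sub>R B ^ i)"
    by (simp add: poly_act_eq_sum coeff scaleR_eq_scalar_mat)
  moreover have "mat_of (\<Sum>i\<le>N. c i *\<^sub>R B ^ i) = mat_of 0"
    using c by (simp add: f_def linear_sum[OF bounded_linear.linear[OF bounded_linear_mat_of]]
        scaleR_cmat.rep_eq zero_cmat.rep_eq)
  ultimately show ?thesis by (metis mat_of_inject)
qed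

text \<open>Let \<open>\<alpha>\<close> be a root of \<open>p\<close>. The induction hypothesis decomposes \<open>(B - \<alpha>) V\<close>. Each part belonging to
  an eigenvalue other than \<open>\<alpha>\<close> can be divided by \<open>B - \<alpha>\<close>; what these quotients leave of \<open>V\<close> is sent
  by \<open>B - \<alpha>\<close> to the part for \<open>\<alpha>\<close>, so it lies in the generalized eigenspace of \<open>\<alpha>\<close>.\<close>
lemma primary_decomposition:
  assumes "p \<noteq> 0" and "poly_act B p V = 0" and "B * V = V * B"
  shows "\<exists>S P m. finite S \<and> V = (\<Sum>\<alpha>\<in>S. P \<alpha>) \<and>
    (\<forall>\<alpha>\<in>S. B * P \<alpha> = P \<alpha> * B \<and> (B - scalar_mat \<alpha>) ^ m * P \<alpha> = 0)"
  using assms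
proof (induction "degree p" arbitrary: p V)
  case 0
  obtain c where c: "p = [:c:]" by (rule degree_eq_zeroE[OF 0(1)[symmetric]])
  then have "V = 0"
    using 0(2,3) by (rule_tac scalar_mat_cancel[of c]) (simp_all add: poly_act_def)
  then show ?case by (intro exI[of _ "{}"]) simp
next
  case (Suc n)
  have "\<not> constant (poly p)" using Suc.hyps(2) by (simp add: constant_degree)
  then obtain \<alpha> where "poly p \<alpha> = 0" using fundamental_theorem_of_algebra by blast
  then obtain q where p: "p = [:- \<alpha>, 1:] * q" using poly_eq_0_iff_dvd by blast
  then have q: "q \<noteq> 0" using Suc.prems(1) by auto
  then have "n = degree q" using Suc.hyps(2) p by (simp add: degree_mult_eq del: mult_pCons_left)
  moreover have "poly_act B q ((B - scalar_mat \<alpha>) * V) = 0"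
    using Suc.prems(2) p by (simp only: poly_act_linear_factor)
  moreover have "B * ((B - scalar_mat \<alpha>) * V) = (B - scalar_mat \<alpha>) * V * B"
    by (rule shift_mult_commute[OF Suc.prems(3)])
  ultimately obtain S P m where S: "finite S" and sum: "(B - scalar_mat \<alpha>) * V = (\<Sum>\<mu>\<in>S. P \<mu>)"
    and P: "\<And>\<mu>. \<mu> \<in> S \<Longrightarrow> B * P \<mu> = P \<mu> * B \<and> (B - scalar_mat \<mu>) ^ m * P \<mu> = 0"
    using Suc.hyps(1)[OF _ q] by blast
  have "\<forall>\<mu>\<in>S - {\<alpha>}. \<exists>R. (B - scalar_mat \<alpha>) * R = P \<mu> \<and> (B - scalar_mat \<mu>) ^ m * R = 0 \<and> B * R = R * B"
    using P by (intro ballI solve_shifted) auto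
  then obtain R where R: "\<And>\<mu>. \<mu> \<in> S - {\<alpha>} \<Longrightarrow>
      (B - scalar_mat \<alpha>) * R \<mu> = P \<mu> \<and> (B - scalar_mat \<mu>) ^ m * R \<mu> = 0 \<and> B * R \<mu> = R \<mu> * B"
    by metis
  define Q where "Q \<mu> = (if \<mu> = \<alpha> then V - (\<Sum>\<mu>\<in>S - {\<alpha>}. R \<mu>) else R \<mu>)" for \<mu>
  have "V = (\<Sum>\<mu>\<in>insert \<alpha> S. Q \<mu>)"
  proof -
    have "(\<Sum>\<mu>\<in>insert \<alpha> S. Q \<mu>) = Q \<alpha> + (\<Sum>\<mu>\<in>S - {\<alpha>}. Q \<mu>)"
      using S by (simp add: sum.insert_remove)
    also have "(\<Sum>\<mu>\<in>S - {\<alpha>}. Q \<mu>) = (\<Sum>\<mu>\<in>S - {\<alpha>}. R \<mu>)" by (simp add: Q_def)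
    finally show ?thesis by (simp add: Q_def)
  qed
  moreover have "B * Q \<mu> = Q \<mu> * B \<and> (B - scalar_mat \<mu>) ^ Suc m * Q \<mu> = 0" if "\<mu> \<in> insert \<alpha> S" for \<mu>
  proof (cases "\<mu> = \<alpha>")
    case True
    have "(\<Sum>\<mu>\<in>S - {\<alpha>}. B * R \<mu>) = (\<Sum>\<mu>\<in>S - {\<alpha>}. R \<mu> * B)" using R by (intro sum.cong) auto
    then have "B * Q \<alpha> = Q \<alpha> * B"
      using Suc.prems(3) by (simp add: Q_def right_diff_distrib left_diff_distrib sum_distrib_left sum_distrib_right)
    moreover have "(B - scalar_mat \<alpha>) * Q \<alpha> = (\<Sum>\<mu>\<in>S. P \<mu>) - (\<Sum>\<mu>\<in>S - {\<alpha>}. P \<mu>)"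
      using R by (simp add: Q_def right_diff_distrib[of "B - scalar_mat \<alpha>"] sum sum_distrib_left)
    then have "(B - scalar_mat \<alpha>) * Q \<alpha> = (if \<alpha> \<in> S then P \<alpha> else 0)"
      using S by (simp add: sum_diff1)
    then have "(B - scalar_mat \<alpha>) ^ m * ((B - scalar_mat \<alpha>) * Q \<alpha>) = 0" using P by simp
    then have "(B - scalar_mat \<alpha>) ^ Suc m * Q \<alpha> = 0" by (simp only: power_Suc2 mult.assoc)
    ultimately show ?thesis using True by simp
  next
    case False
    then show ?thesis using R that by (simp add: Q_def mult.assoc)
  qed
  ultimately show ?case using S
    by (intro exI[of _ "insert \<alpha> S"] exI[of _ Q] exI[of _ "Suc m"]) auto
qed

text \<open>Primary decomposition of the identity matrix. The parts are orthogonal because the product of two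
  of them is annihilated by powers of two different shifts of \<open>B\<close>, and then idempotent because they
  add up to \<open>1\<close>.\<close>
lemma spectral_projections:
  fixes B :: "'n::finite cmat"
  obtains S P m where "finite S" "(\<Sum>\<alpha>\<in>S. P \<alpha>) = 1"
    "\<And>\<alpha>. \<alpha> \<in> S \<Longrightarrow> B * P \<alpha> = P \<alpha> * B"
    "\<And>\<alpha>. \<alpha> \<in> S \<Longrightarrow> (B - scalar_mat \<alpha>) ^ m * P \<alpha> = 0"
    "\<And>\<alpha> \<mu>. \<alpha> \<in> S \<Longrightarrow> \<mu> \<in> S \<Longrightarrow> P \<alpha> * P \<mu> = (if \<alpha> = \<mu> then P \<alpha> else 0)"
proof -
  obtain p where "p \<noteq> 0" "poly_act B p 1 = 0" using annihilating_polynomial_exists by blast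
  moreover have "B * 1 = 1 * B" by simp
  ultimately obtain S P m where S: "finite S" and one: "1 = (\<Sum>\<alpha>\<in>S. P \<alpha>)"
    and P: "\<And>\<alpha>. \<alpha> \<in> S \<Longrightarrow> B * P \<alpha> = P \<alpha> * B" "\<And>\<alpha>. \<alpha> \<in> S \<Longrightarrow> (B - scalar_mat \<alpha>) ^ m * P \<alpha> = 0"
    using primary_decomposition[of p B 1] by blast
  have orth: "P \<alpha> * P \<mu> = 0" if "\<alpha> \<in> S" "\<mu> \<in> S" "\<alpha> \<noteq> \<mu>" for \<alpha> \<mu>
  proof (rule coprime_powers_cancel[OF _ _ that(3)])
    show "(B - scalar_mat \<alpha>) ^ m * (P \<alpha> * P \<mu>) = 0" using P(2)[OF that(1)] by (simp flip: mult.assoc)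
    have "(B - scalar_mat \<mu>) ^ m * P \<alpha> = P \<alpha> * (B - scalar_mat \<mu>) ^ m"
      by (intro power_commuting_commutes shift_commute P(1) that(1))
    then show "(B - scalar_mat \<mu>) ^ m * (P \<alpha> * P \<mu>) = 0"
      using P(2)[OF that(2)] by (metis mult.assoc mult_zero_right)
  qed
  have idem: "P \<alpha> * P \<alpha> = P \<alpha>" if "\<alpha> \<in> S" for \<alpha>
  proof -
    have "P \<alpha> = (\<Sum>\<mu>\<in>S. P \<alpha> * P \<mu>)" using one by (metis mult_1_right sum_distrib_left)
    also have "\<dots> = (\<Sum>\<mu>\<in>S. if \<mu> = \<alpha> then P \<alpha> * P \<alpha> else 0)"
      using orth that by (intro sum.cong) auto
    finally show ?thesis using that S by simp
  qed
  show ?thesis using that[of S P m] S one P orth idem by auto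
qed

text \<open>If \<open>z\<close> is not among the eigenvalues, every part of the identity can be divided by \<open>W - z\<close>.\<close>
lemma finite_spectrum:
  fixes W :: "'n::finite cmat"
  obtains S where "finite S" "\<And>z. z \<notin> S \<Longrightarrow> \<exists>R. (W - scalar_mat z) * R = 1"
proof -
  obtain S P m where S: "finite S" "(\<Sum>\<alpha>\<in>S. P \<alpha>) = 1"
    and P: "\<And>\<alpha>. \<alpha> \<in> S \<Longrightarrow> W * P \<alpha> = P \<alpha> * W" "\<And>\<alpha>. \<alpha> \<in> S \<Longrightarrow> (W - scalar_mat \<alpha>) ^ m * P \<alpha> = 0"
    using spectral_projections[of W] by metis
  have "\<exists>R. (W - scalar_mat z) * R = 1" if "z \<notin> S" for z
  proof -
    have "\<forall>\<alpha>\<in>S. \<exists>R. (W - scalar_mat z) * R = P \<alpha>"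
      using solve_shifted[of W _ m _ z] P that by metis
    then obtain R where "\<And>\<alpha>. \<alpha> \<in> S \<Longrightarrow> (W - scalar_mat z) * R \<alpha> = P \<alpha>" by metis
    then have "(W - scalar_mat z) * (\<Sum>\<alpha>\<in>S. R \<alpha>) = 1" using S(2) by (simp add: sum_distrib_left)
    then show ?thesis by blast
  qed
  with S(1) that show ?thesis by blast
qed

section \<open>Eigenfunctions of an irrational flow on the torus\<close>

lemma integer_lattice_closed [intro]:
  "0 \<in> integer_lattice"
  "k \<in> integer_lattice \<Longrightarrow> l \<in> integer_lattice \<Longrightarrow> k + l \<in> integer_lattice"
  "k \<in> integer_lattice \<Longrightarrow> l \<in> integer_lattice \<Longrightarrow> k - l \<in> integer_lattice"
  "k \<in> integer_lattice \<Longrightarrow> - k \<in> integer_lattice"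
  "axis i 1 \<in> integer_lattice"
  by (auto simp: integer_lattice_def axis_def)

lemma inner_lattice_Ints: "k \<in> integer_lattice \<Longrightarrow> l \<in> integer_lattice \<Longrightarrow> k \<bullet> l \<in> \<int>"
  by (auto simp: integer_lattice_def inner_vec_def intro!: Ints_sum Ints_mult)

lemma rationally_independentD:
  "rationally_independent \<omega> \<Longrightarrow> k \<in> integer_lattice \<Longrightarrow> k \<bullet> \<omega> = 0 \<Longrightarrow> k = 0"
  by (auto simp: rationally_independent_def)

lemma periodicD:
  assumes "torus_function 1 f" "k \<in> integer_lattice"
  shows "f (\<theta> + k) = f \<theta>" and "f (\<theta> - k) = f \<theta>"
proof -
  show 1: "f (\<theta> + k) = f \<theta>" for \<theta> using assms by (simp add: torus_function_def)
  show "f (\<theta> - k) = f \<theta>" using 1[of "\<theta> - k"] by simp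
qed

text \<open>Kronecker's theorem, applied to the coordinates of \<open>\<omega>\<close> in some enumeration. An integer relation
  between the coordinates is a lattice vector orthogonal to \<open>\<omega>\<close>; in particular the coordinates are
  pairwise distinct, because a difference of two unit vectors is such a vector otherwise.\<close>
lemma irrational_line_dense:
  fixes \<omega> \<alpha> :: "real ^ 'd"
  assumes \<omega>: "rationally_independent \<omega>" and "\<epsilon> > 0"
  obtains t k where "k \<in> integer_lattice" "dist (t *\<^sub>R \<omega> - k) \<alpha> < \<epsilon>"
proof -
  define n where "n = CARD('d)"
  obtain h :: "nat \<Rightarrow> 'd" where h: "bij_betw h {..<n} UNIV"
    using ex_bij_betw_nat_finite[of "UNIV :: 'd set"] by (auto simp: n_def atLeast0LessThan)
  have inj: "inj (($) \<omega>)"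
  proof (rule injI, rule ccontr)
    fix a b assume ab: "\<omega> $ a = \<omega> $ b" "a \<noteq> b"
    have "axis a 1 - axis b (1::real) = 0"
    proof (rule rationally_independentD[OF \<omega>])
      show "(axis a 1 - axis b 1) \<bullet> \<omega> = 0" using ab(1) by (simp add: inner_diff_left inner_axis')
    qed auto
    then have "(axis a 1 - axis b (1::real)) $ a = 0" by simp
    then show False using ab(2) by (simp add: axis_def)
  qed
  define \<theta> where "\<theta> = (($) \<omega>) \<circ> h"
  have inj\<theta>: "inj_on \<theta> {..<n}"
    unfolding \<theta>_def using h inj by (intro comp_inj_on) (auto simp: bij_betw_def intro: inj_on_subset)
  have img: "\<theta> ` {..<n} = range (($) \<omega>)" using h
    by (auto simp: \<theta>_def bij_betw_def simp flip: image_image)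
  interpret Z: Modules.module "(\<lambda>r. (*) (real_of_int r))"
    by (simp add: Modules.module.intro distrib_left mult.commute)
  have indep: "Z.independent (\<theta> ` {..<n})"
  proof
    assume "Z.dependent (\<theta> ` {..<n})"
    then obtain T u where T: "finite T" "T \<subseteq> range (($) \<omega>)" "(\<Sum>v\<in>T. real_of_int (u v) * v) =
        0" "\<exists>v\<in>T. u v \<noteq> 0"
      unfolding Z.dependent_explicit img by auto
    define k :: "real ^ 'd" where "k = (\<chi> i. if \<omega> $ i \<in> T then of_int (u (\<omega> $ i)) else 0)"
    have "k \<bullet> \<omega> = (\<Sum>i\<in>UNIV. if \<omega> $ i \<in> T then of_int (u (\<omega> $ i)) * \<omega> $ i else 0)"
      unfolding inner_vec_def by (intro sum.cong) (auto simp: k_def)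
    also have "\<dots> = (\<Sum>v\<in>range (($) \<omega>). if v \<in> T then of_int (u v) * v else 0)"
      by (simp add: sum.reindex[OF inj])
    also have "\<dots> = (\<Sum>v\<in>T. of_int (u v) * v)"
      using T(2) by (intro sum.mono_neutral_cong_right) auto
    finally have "k = 0"
      using T(3) by (intro rationally_independentD[OF \<omega>]) (auto simp: k_def integer_lattice_def)
    moreover obtain i where "\<omega> $ i \<in> T" "u (\<omega> $ i) \<noteq> 0" using T(2,4) by auto
    then have "k $ i \<noteq> 0" by (simp add: k_def)
    ultimately show False by simp
  qed
  have n: "n > 0" by (simp add: n_def)
  obtain t g where tg: "\<And>i. i < n \<Longrightarrow> \<bar>t * \<theta> i - of_int (g i) - \<alpha> $ h i\<bar> < \<epsilon> / n"
    by (rule Kronecker_thm_1[OF indep inj\<theta>, of "\<epsilon> / n" "\<lambda>i. \<alpha> $ h i"]) (use assms(2) n in auto)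
  define k :: "real ^ 'd" where "k = (\<chi> i. of_int (g (inv_into {..<n} h i)))"
  have "dist (t *\<^sub>R \<omega> - k) \<alpha> \<le> (\<Sum>i\<in>UNIV. \<bar>(t *\<^sub>R \<omega> - k - \<alpha>) $ i\<bar>)"
    unfolding dist_norm by (rule norm_le_l1_cart)
  also have "\<dots> < (\<Sum>i::'d\<in>UNIV. \<epsilon> / n)"
  proof (rule sum_strict_mono)
    fix i :: 'd
    have "inv_into {..<n} h i \<in> {..<n}" "h (inv_into {..<n} h i) = i"
      using h by (auto simp: bij_betw_def inv_into_into f_inv_into_f simp del: lessThan_iff)
    then show "\<bar>(t *\<^sub>R \<omega> - k - \<alpha>) $ i\<bar> < \<epsilon> / n"
      using tg[of "inv_into {..<n} h i"] by (simp add: k_def \<theta>_def)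
  qed auto
  also have "\<dots> = \<epsilon>" using n by (simp add: n_def)
  finally have "dist (t *\<^sub>R \<omega> - k) \<alpha> < \<epsilon>" .
  moreover have "k \<in> integer_lattice" by (simp add: k_def integer_lattice_def)
  ultimately show ?thesis using that by blast
qed

lemma line_invariant_constant:
  fixes f :: "real ^ 'd \<Rightarrow> 'b::metric_space"
  assumes \<omega>: "rationally_independent \<omega>" and f: "continuous_on UNIV f" "torus_function 1 f"
    and inv: "\<And>t. f (t *\<^sub>R \<omega>) = f 0"
  shows "f \<theta> = f 0"
proof (rule ccontr)
  assume "f \<theta> \<noteq> f 0"
  then obtain \<delta> where \<delta>: "\<delta> > 0" "\<And>x. dist x \<theta> < \<delta> \<Longrightarrow> dist (f x) (f \<theta>) < dist (f 0) (f \<theta>)"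
    using f(1) unfolding continuous_on_iff by (metis UNIV_I zero_less_dist_iff)
  obtain t k where "k \<in> integer_lattice" "dist (t *\<^sub>R \<omega> - k) \<theta> < \<delta>"
    using irrational_line_dense[OF \<omega> \<delta>(1)] .
  then show False using \<delta>(2)[of "t *\<^sub>R \<omega> - k"] periodicD[OF f(2)] inv by simp
qed

lemma periodic_bounded:
  fixes f :: "real ^ 'd \<Rightarrow> 'b::real_normed_vector"
  assumes "continuous_on UNIV f" "torus_function 1 f"
  obtains C where "\<And>\<theta>. norm (f \<theta>) \<le> C"
proof -
  have "compact (f ` cbox 0 1)"
    by (intro compact_continuous_image compact_cbox continuous_on_subset[OF assms(1)]) auto
  then obtain C where C: "\<forall>\<theta>\<in>cbox 0 1. norm (f \<theta>) \<le> C"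
    by (auto dest!: compact_imp_bounded simp: bounded_iff)
  have "norm (f \<theta>) \<le> C" for \<theta>
  proof -
    define k :: "real ^ 'd" where "k = (\<chi> i. of_int \<lfloor>\<theta> $ i\<rfloor>)"
    have "norm (f (\<theta> - k)) \<le> C"
    proof (rule C[rule_format])
      have "0 \<le> x - of_int \<lfloor>x\<rfloor>" "x - of_int \<lfloor>x\<rfloor> \<le> 1" for x :: real by linarith+
      then show "\<theta> - k \<in> cbox 0 1" by (simp add: mem_box_cart k_def)
    qed
    then show ?thesis using periodicD(2)[OF assms(2), of k] by (simp add: k_def integer_lattice_def)
  qed
  with that show ?thesis by blast
qed

text \<open>Both signs of \<open>t\<close> are used: a nonzero real part makes the exponential unbounded in one of the two
  time directions.\<close>
lemma exponential_bounded_imp_Re_zero: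
  fixes \<nu> :: complex and c C :: real
  assumes "c > 0" and bound: "\<And>t. exp (Re \<nu> * t) * c \<le> C"
  shows "Re \<nu> = 0"
proof (rule ccontr)
  assume "Re \<nu> \<noteq> 0"
  then have "exp (C / c) * c \<le> C" using bound[of "C / c / Re \<nu>"] by simp
  moreover have "(1 + C / c) * c \<le> exp (C / c) * c"
    using assms(1) exp_ge_add_one_self by (intro mult_right_mono) auto
  ultimately show False using assms(1) by (simp add: distrib_right)
qed

text \<open>A continuous function into the discrete set \<open>2\<pi>i\<int>\<close>.\<close>
lemma exp_eq_one_constant:
  fixes q :: "'a::real_normed_vector \<Rightarrow> complex"
  assumes "continuous_on UNIV q" and "\<And>x. exp (q x) = 1"
  shows "q x = q y"
proof -
  have "q constant_on UNIV"
  proof (rule continuous_discrete_range_constant[OF connected_UNIV assms(1)])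
    fix x
    have "2 * pi \<le> norm (q y - q x)" if ne: "q y \<noteq> q x" for y
    proof -
      have "exp (q y) = exp (q x)" by (simp add: assms(2))
      then obtain n :: int where n: "q y = q x + of_int (2 * n) * pi * \<i>" by (auto simp: exp_eq)
      then have "n \<noteq> 0" using ne by auto
      then have "1 \<le> \<bar>real_of_int n\<bar>" by linarith
      then have "2 * pi * 1 \<le> 2 * pi * \<bar>real_of_int n\<bar>" by (intro mult_left_mono) auto
      then show ?thesis using n by (simp add: norm_mult algebra_simps)
    qed
    then show "\<exists>e>0. \<forall>y. y \<in> UNIV \<and> q y \<noteq> q x \<longrightarrow> e \<le> norm (q y - q x)"
      by (intro exI[of _ "2 * pi"]) auto
  qed
  then show ?thesis by (auto simp: constant_on_def)
qed

lemma exp_line_inject: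
  assumes "\<And>t::real. exp (a * of_real t) = exp (b * of_real t)"
  shows "a = (b :: complex)"
proof -
  have "exp ((a - b) * of_real t) = 1" for t :: real
    using assms[of t] by (simp add: left_diff_distrib exp_diff)
  moreover have "continuous_on UNIV (\<lambda>t::real. (a - b) * of_real t)" by (intro continuous_intros)
  ultimately have "(a - b) * of_real 1 = (a - b) * of_real (0::real)"
    by (rule exp_eq_one_constant[of "\<lambda>t. (a - b) * of_real t", rotated])
  then show ?thesis by simp
qed

lemma additive_of_int:
  fixes G :: "'a::real_vector \<Rightarrow> complex"
  assumes "Modules.additive G"
  shows "G (of_int n *\<^sub>R x) = of_int n * G x"
proof -
  interpret Modules.additive G by fact
  have nat: "G (of_nat m *\<^sub>R x) = of_nat m * G x" for m
    by (induction m) (simp_all add: zero add scaleR_left_distrib distrib_right)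
  show ?thesis
  proof (cases n)
    case (nonneg m)
    then show ?thesis using nat[of m] by simp
  next
    case (neg m)
    then show ?thesis using nat[of "Suc m"] by (simp add: minus del: of_nat_Suc)
  qed
qed

text \<open>For \<open>k\<close> in the integer lattice this is a character of the torus; half-integral \<open>k\<close> give characters
  of its double cover.\<close>
definition character :: "real ^ 'd \<Rightarrow> real ^ 'd \<Rightarrow> complex"
  where "character k \<theta> = exp (2 * pi * \<i> * of_real (k \<bullet> \<theta>))"

lemma character_add: "character k (\<theta> + s) = character k \<theta> * character k s"
  by (simp add: character_def inner_add_right distrib_left exp_add)

lemma character_add_left: "character (k + l) \<theta> = character k \<theta> * character l \<theta>"
  by (simp add: character_def inner_add_left distrib_left exp_add)

lemma character_zero [simp]: "character k 0 = 1"
  by (simp add: character_def)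

lemma cnj_character: "cnj (character k \<theta>) * character k \<theta> = 1"
  by (simp add: character_def exp_cnj flip: exp_add)

lemma continuous_on_character: "continuous_on S (character k)"
  unfolding character_def by (intro continuous_intros)

lemma character_scaleR: "character k (t *\<^sub>R \<omega>) = exp (2 * pi * \<i> * of_real (k \<bullet> \<omega>) * of_real t)"
  by (simp add: character_def mult_ac)

lemma character_half_lattice_periodic:
  assumes "2 *\<^sub>R m \<in> integer_lattice" "k \<in> integer_lattice"
  shows "character m (2 *\<^sub>R k) = 1"
proof -
  have "m \<bullet> (2 *\<^sub>R k) = (2 *\<^sub>R m) \<bullet> k" by simp
  then obtain n where "m \<bullet> (2 *\<^sub>R k) = of_int n"
    using inner_lattice_Ints[OF assms] by (metis Ints_cases)
  then have "character m (2 *\<^sub>R k) = exp (of_int (2 * n) * of_real pi * \<i>)"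
    unfolding character_def by (simp add: mult_ac)
  moreover have "exp (of_int (2 * n) * of_real pi * \<i>) = 1"
    unfolding exp_eq_1 by (intro conjI exI[of _ n]) simp_all
  ultimately show ?thesis by simp
qed

text \<open>An eigenfunction of the flow has constant modulus, since its modulus is invariant and orbits are
  dense. Hence it has no zeros and, again by density, it is multiplicative up to the factor \<open>f 0\<close>. Its
  continuous logarithm \<open>G\<close>, normalized at \<open>0\<close>, is additive and takes the unit vectors into \<open>2\<pi>i\<int>\<close>,
  which defines \<open>k\<close>. The additive function \<open>q = G - 2\<pi>i\<langle>k,-\<rangle>\<close> vanishes on the lattice, so it is
  periodic and bounded, and a bounded additive function is zero.\<close>
lemma line_eigenfunction:
  fixes f :: "real ^ 'd \<Rightarrow> complex"
  assumes \<omega>: "rationally_independent \<omega>" and f: "continuous_on UNIV f" "torus_function 1 f"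
    and eigen: "\<And>\<theta> t. f (\<theta> + t *\<^sub>R \<omega>) = exp (\<nu> * of_real t) * f \<theta>"
    and nz: "f \<theta>\<^sub>0 \<noteq> 0"
  obtains k where "k \<in> integer_lattice" "\<nu> = 2 * pi * \<i> * of_real (k \<bullet> \<omega>)"
    "\<And>\<theta>. f \<theta> = character k \<theta> * f 0"
proof -
  obtain C where C: "\<And>\<theta>. norm (f \<theta>) \<le> C" using periodic_bounded[OF f] by blast
  have "exp (Re \<nu> * t) * norm (f \<theta>\<^sub>0) \<le> C" for t
    using C[of "\<theta>\<^sub>0 + t *\<^sub>R \<omega>"] by (simp add: eigen norm_mult)
  then have Re: "Re \<nu> = 0" using exponential_bounded_imp_Re_zero nz by (metis zero_less_norm_iff)
  have norm: "norm (f \<theta>) = norm (f 0)" for \<theta>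
  proof (rule line_invariant_constant[OF \<omega>, of "\<lambda>\<theta>. norm (f \<theta>)"])
    show "norm (f (t *\<^sub>R \<omega>)) = norm (f 0)" for t using eigen[of 0 t] by (simp add: norm_mult Re)
  qed (use f in \<open>auto intro: continuous_on_norm simp: torus_function_def\<close>)
  have nonzero: "f \<theta> \<noteq> 0" for \<theta> using norm[of \<theta>] norm[of \<theta>\<^sub>0] nz by auto
  have mult: "f (\<theta> + s) * f 0 = f \<theta> * f s" for \<theta> s
  proof -
    have "f (\<theta> + s) / f s = f (\<theta> + 0) / f 0"
    proof (rule line_invariant_constant[OF \<omega>, of "\<lambda>s. f (\<theta> + s) / f s"])
      show "continuous_on UNIV (\<lambda>s. f (\<theta> + s) / f s)"
        by (intro continuous_intros continuous_on_compose2[OF f(1)] f(1)) (auto simp: nonzero)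
      show "f (\<theta> + t *\<^sub>R \<omega>) / f (t *\<^sub>R \<omega>) = f (\<theta> + 0) / f 0" for t
        using eigen[of \<theta> t] eigen[of 0 t] by simp
    qed (use f(2) in \<open>auto simp: torus_function_def simp flip: add.assoc\<close>)
    then show ?thesis using nonzero by (simp add: field_simps)
  qed
  have "\<exists>g. continuous_on UNIV g \<and> (\<forall>\<theta>. f \<theta> = exp (g \<theta>))"
    by (rule continuous_logarithm_on_contractible[OF f(1) contractible_UNIV nonzero]) auto
  then obtain g where cont_g: "continuous_on UNIV g" and g: "\<And>\<theta>. f \<theta> = exp (g \<theta>)"
    by blast
  define G where "G \<theta> = g \<theta> - g 0" for \<theta>
  have G_exp: "f \<theta> = exp (G \<theta>) * f 0" for \<theta> by (simp add: G_def g exp_diff)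
  interpret G: Modules.additive G
  proof
    fix \<theta> s
    define q where "q s = g (\<theta> + s) + g 0 - (g \<theta> + g s)" for s
    have "continuous_on UNIV q"
      unfolding q_def by (intro continuous_intros continuous_on_compose2[OF cont_g] cont_g) auto
    moreover have "exp (q s) = 1" for s
      using mult[of \<theta> s] by (simp add: q_def g exp_diff exp_add)
    ultimately have "q s = q 0" by (rule exp_eq_one_constant)
    then show "G (\<theta> + s) = G \<theta> + G s" by (simp add: q_def G_def algebra_simps)
  qed
  have additive_G: "Modules.additive G" by unfold_locales
  have "\<exists>n. G (axis i 1) = of_int n * (2 * pi * \<i>)" for i
  proof -
    have "f (axis i 1) = f 0" using periodicD(1)[OF f(2), of "axis i 1" 0] by auto
    then have "exp (G (axis i 1)) = 1" using G_exp[of "axis i 1"] nonzero[of 0] by simp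
    then have "exp (G (axis i 1)) = exp 0" by simp
    then show ?thesis by (auto simp only: exp_eq) (auto simp: mult_ac)
  qed
  then obtain n where n: "\<And>i. G (axis i 1) = of_int (n i) * (2 * pi * \<i>)" by metis
  define k :: "real ^ 'd" where "k = (\<chi> i. of_int (n i))"
  have k: "k \<in> integer_lattice" by (simp add: k_def integer_lattice_def)
  have G_lattice: "G l = 2 * pi * \<i> * of_real (k \<bullet> l)" if "l \<in> integer_lattice" for l
  proof -
    have "\<exists>m. l $ i = of_int m" for i using that by (auto simp: integer_lattice_def elim: Ints_cases)
    then obtain m where m: "\<And>i. l $ i = of_int (m i)" by metis
    have "l = (\<Sum>i\<in>UNIV. of_int (m i) *\<^sub>R axis i 1)"
      by (simp add: vec_eq_iff axis_def m if_distrib cong: if_cong)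
    then have "G l = (\<Sum>i\<in>UNIV. of_int (m i) * (of_int (n i) * (2 * pi * \<i>)))"
      by (simp only: G.sum additive_of_int[OF additive_G] n)
    also have "\<dots> = 2 * pi * \<i> * of_real (k \<bullet> l)"
      by (simp add: inner_vec_def k_def m sum_distrib_left mult_ac)
    finally show ?thesis .
  qed
  define q where "q \<theta> = G \<theta> - 2 * pi * \<i> * of_real (k \<bullet> \<theta>)" for \<theta>
  have additive_q: "Modules.additive q"
    by unfold_locales (simp add: q_def G.add inner_add_right algebra_simps)
  have "torus_function 1 q"
    using G_lattice by (simp add: torus_function_def q_def G.add inner_add_right algebra_simps)
  moreover have "continuous_on UNIV q" unfolding q_def G_def by (intro continuous_intros cont_g)
  ultimately obtain D where D: "\<And>\<theta>. norm (q \<theta>) \<le> D" using periodic_bounded by blast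
  have q0: "q \<theta> = 0" for \<theta>
  proof (rule ccontr)
    assume "q \<theta> \<noteq> 0"
    then obtain N :: nat where "D < of_nat N * norm (q \<theta>)" using reals_Archimedean3
      by (metis zero_less_norm_iff)
    also have "\<dots> = norm (q (of_int (int N) *\<^sub>R \<theta>))"
      by (simp only: additive_of_int[OF additive_q] norm_mult) simp
    also have "\<dots> \<le> D" by (rule D)
    finally show False by simp
  qed
  then have fchar: "f \<theta> = character k \<theta> * f 0" for \<theta>
    using G_exp[of \<theta>] q0[of \<theta>] by (simp add: q_def character_def)
  have "\<nu> = 2 * pi * \<i> * of_real (k \<bullet> \<omega>)"
  proof (rule exp_line_inject)
    fix t
    show "exp (\<nu> * of_real t) = exp (2 * pi * \<i> * of_real (k \<bullet> \<omega>) * of_real t)"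
      using fchar[of "t *\<^sub>R \<omega>"] eigen[of 0 t] nonzero[of 0] by (simp add: character_def mult_ac)
  qed
  then show ?thesis using that k fchar by blast
qed

section \<open>Bounded orbits of the Sylvester flow\<close>

lemma exp_commutes_of_commutes:
  fixes A P :: "'a::{real_normed_algebra_1,banach}"
  assumes "A * P = P * A"
  shows "exp A * P = P * exp A"
proof -
  have "(\<lambda>n. A ^ n /\<^sub>R fact n * P) sums (exp A * P)"
    by (rule bounded_linear.sums[OF bounded_linear_mult_left exp_converges])
  moreover have "(\<lambda>n. P * (A ^ n /\<^sub>R fact n)) sums (P * exp A)"
    by (rule bounded_linear.sums[OF bounded_linear_mult_right exp_converges])
  moreover have "A ^ n /\<^sub>R fact n * P = P * (A ^ n /\<^sub>R fact n)" for n
    by (simp add: power_commuting_commutes[OF assms])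
  ultimately show ?thesis by (simp add: sums_unique2)
qed

lemma exp_similarity:
  fixes A P Q :: "'a::{real_normed_algebra_1,banach}"
  assumes "P * Q = 1" "Q * P = 1"
  shows "exp (P * A * Q) = P * exp A * Q"
proof -
  have "(P * A * Q) ^ n = P * A ^ n * Q" for n
  proof (induction n)
    case (Suc n)
    have "P * A * Q * (P * A ^ n * Q) = P * A * (Q * P) * A ^ n * Q" by (simp only: mult.assoc)
    then show ?case using Suc assms(2) by (simp add: mult.assoc)
  qed (simp add: assms)
  moreover have "(\<lambda>n. P * (A ^ n /\<^sub>R fact n) * Q) sums (P * exp A * Q)"
    by (intro bounded_linear.sums[OF bounded_linear_mult_left]
        bounded_linear.sums[OF bounded_linear_mult_right] exp_converges)
  ultimately have "(\<lambda>n. (P * A * Q) ^ n /\<^sub>R fact n) sums (P * exp A * Q)" by simp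
  then show ?thesis using exp_converges sums_unique2 by blast
qed

lemma exp_scalar_mat: "exp (scalar_mat c :: 'n::finite cmat) = scalar_mat (exp c)"
proof -
  have "scalar_mat c ^ n = (scalar_mat (c ^ n) :: 'n cmat)" for n
    by (induction n) (simp_all add: scalar_mat_mult)
  moreover have "(\<lambda>n. scalar_mat (c ^ n /\<^sub>R fact n)) sums (scalar_mat (exp c) :: 'n cmat)"
    by (rule bounded_linear.sums[OF bounded_linear_scalar_mat exp_converges])
  ultimately have "(\<lambda>n. scalar_mat c ^ n /\<^sub>R fact n) sums (scalar_mat (exp c) :: 'n cmat)"
    by (simp add: linear_cmul[OF bounded_linear.linear[OF bounded_linear_scalar_mat]])
  then show ?thesis using exp_converges sums_unique2 by blast
qed

text \<open>The solution at time \<open>t\<close> of the linear equation \<open>x' = A x - x B\<close> with initial value \<open>x\<close>.\<close>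
definition flow :: "'a::{real_normed_algebra_1,banach} \<Rightarrow> 'a \<Rightarrow> 'a \<Rightarrow> real \<Rightarrow> 'a"
  where "flow A B x t = exp (t *\<^sub>R A) * x * exp (t *\<^sub>R - B)"

definition sylvester :: "'a::ring \<Rightarrow> 'a \<Rightarrow> 'a \<Rightarrow> 'a"
  where "sylvester A B x = A * x - x * B"

lemma sylvester_diff: "sylvester A B (x - y) = sylvester A B x - sylvester A B y"
  by (simp add: sylvester_def algebra_simps)

lemma sylvester_of_flow: "sylvester A B (flow A B x t) = flow A B (sylvester A B x) t"
proof -
  have "exp (t *\<^sub>R A) * A = A * exp (t *\<^sub>R A)" by (rule exp_commutes_of_commutes) simp
  moreover have "exp (t *\<^sub>R - B) * B = B * exp (t *\<^sub>R - B)" by (rule exp_commutes_of_commutes) simp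
  ultimately show ?thesis
    by (simp add: flow_def sylvester_def left_diff_distrib right_diff_distrib mult.assoc)
      (simp flip: mult.assoc)
qed

lemma flow_has_vector_derivative:
  "(flow A B x has_vector_derivative flow A B (sylvester A B x) t) (at t)"
proof -
  have "((\<lambda>t. exp (t *\<^sub>R A) * x) has_vector_derivative exp (t *\<^sub>R A) * A * x) (at t)"
    by (rule bounded_linear.has_vector_derivative[OF bounded_linear_mult_left exp_scaleR_has_vector_derivative_right])
  from has_vector_derivative_mult[OF this exp_scaleR_has_vector_derivative_left[of "- B" t]]
  show ?thesis unfolding flow_def sylvester_def
    by (rule has_vector_derivative_eq_rhs) (simp add: algebra_simps)
qed

lemma flow_eq_const:
  assumes "sylvester A B x = 0"
  shows "flow A B x t = x"
proof -
  have "(flow A B x has_derivative (\<lambda>h. 0)) (at s)" for s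
    using flow_has_vector_derivative[of A B x s]
      by (simp add: assms flow_def has_vector_derivative_def)
  then obtain c where "\<And>s. flow A B x s = c"
    using has_derivative_zero_constant[of UNIV "flow A B x"] by auto
  moreover have "flow A B x 0 = x" by (simp add: flow_def)
  ultimately show ?thesis by metis
qed

lemma flow_eq_affine:
  assumes "sylvester A B (sylvester A B x) = 0"
  shows "flow A B x t = x + t *\<^sub>R sylvester A B x"
proof -
  define f where "f s = flow A B x s - s *\<^sub>R sylvester A B x" for s
  have "(f has_vector_derivative 0) (at s)" for s
    unfolding f_def
    by (rule has_vector_derivative_eq_rhs[OF has_vector_derivative_diff
        [OF flow_has_vector_derivative has_vector_derivative_scaleR[OF DERIV_ident has_vector_derivative_const]]])
      (simp add: flow_eq_const assms)
  then have "(f has_derivative (\<lambda>h. 0)) (at s)" for s by (simp add: has_vector_derivative_def)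
  then obtain c where "\<And>s. f s = c" using has_derivative_zero_constant[of UNIV f] by auto
  then have "f t = f 0" by simp
  then show ?thesis by (simp add: f_def flow_def algebra_simps)
qed

text \<open>The weight is there to absorb the subtraction of scalars \<open>a\<close> and \<open>b\<close> from \<open>A\<close> and \<open>B\<close>, which
  multiplies the flow by \<open>exp(-(a - b)t)\<close>; only the real part of the exponent is visible in the norm.\<close>
definition weighted_flow_bounded where
  "weighted_flow_bounded c A B x \<longleftrightarrow> (\<exists>C. \<forall>t. exp (c * t) * norm (flow A B x t) \<le> C)"

lemma weighted_flow_bounded_sylvester:
  assumes "weighted_flow_bounded c A B x"
  shows "weighted_flow_bounded c A B (sylvester A B x)"
proof -
  obtain C where C: "\<And>t. exp (c * t) * norm (flow A B x t) \<le> C"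
    using assms by (auto simp: weighted_flow_bounded_def)
  have "exp (c * t) * norm (flow A B (sylvester A B x) t) \<le> (norm A + norm B) * C" for t
  proof -
    have "norm (sylvester A B (flow A B x t)) \<le> norm (A * flow A B x t) + norm (flow A B x t * B)"
      unfolding sylvester_def by (rule norm_triangle_ineq4)
    also have "\<dots> \<le> norm A * norm (flow A B x t) + norm (flow A B x t) * norm B"
      by (intro add_mono norm_mult_ineq)
    finally have "exp (c * t) * norm (flow A B (sylvester A B x) t)
        \<le> exp (c * t) * ((norm A + norm B) * norm (flow A B x t))"
      by (intro mult_left_mono) (simp_all add: sylvester_of_flow algebra_simps)
    also have "\<dots> \<le> (norm A + norm B) * C"
      using mult_left_mono[OF C[of t], of "norm A + norm B"] by (simp add: mult_ac)
    finally show ?thesis .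
  qed
  then show ?thesis by (auto simp: weighted_flow_bounded_def)
qed

text \<open>The flow is constant on \<open>sylvester A B x\<close>. If this vector is nonzero, boundedness in both time
  directions forces the weight to be trivial. But then \<open>x + t *\<^sub>R sylvester A B x\<close> is bounded in \<open>t\<close>.\<close>
lemma weighted_flow_bounded_square_zero:
  assumes bounded: "weighted_flow_bounded c A B x"
    and zero: "sylvester A B (sylvester A B x) = 0"
  shows "sylvester A B x = 0"
proof (rule ccontr)
  let ?y = "sylvester A B x"
  assume y: "?y \<noteq> 0"
  obtain C where C: "\<And>t. exp (c * t) * norm (flow A B ?y t) \<le> C"
    using weighted_flow_bounded_sylvester[OF bounded] by (auto simp: weighted_flow_bounded_def)
  have "exp (Re (of_real c) * t) * norm ?y \<le> C" for t
    using C[of t] by (simp add: flow_eq_const zero)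
  then have c: "c = 0" using exponential_bounded_imp_Re_zero[of "norm ?y" "of_real c" C] y by simp
  obtain C where C: "\<And>t. exp (c * t) * norm (flow A B x t) \<le> C"
    using bounded by (auto simp: weighted_flow_bounded_def)
  define t where "t = (C + norm x + 1) / norm ?y"
  have "norm (t *\<^sub>R ?y) \<le> norm (x + t *\<^sub>R ?y) + norm x"
    using norm_triangle_ineq4[of "x + t *\<^sub>R ?y" x] by simp
  also have "\<dots> \<le> C + norm x" using C[of t] by (simp add: c flow_eq_affine zero)
  finally have "\<bar>t\<bar> * norm ?y \<le> C + norm x" by simp
  moreover have "t * norm ?y = C + norm x + 1" using y by (simp add: t_def)
  moreover have "t * norm ?y \<le> \<bar>t\<bar> * norm ?y" by (intro mult_right_mono) auto
  ultimately show False by linarith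
qed

text \<open>Two applications of \<open>sylvester A B\<close> vanish on its \<open>k\<close>-th iterate at \<open>x\<close> if \<open>m = k + 2\<close>, so by the
  previous lemma \<open>m\<close> can be lowered until it is \<open>1\<close>.\<close>
lemma weighted_flow_bounded_nilpotent:
  assumes bounded: "weighted_flow_bounded c A B x"
    and "(sylvester A B ^^ m) x = 0"
  shows "sylvester A B x = 0"
  using assms(2)
proof (induction m)
  case (Suc m)
  show ?case
  proof (cases m)
    case (Suc k)
    have "weighted_flow_bounded c A B ((sylvester A B ^^ k) x)" for k
      by (induction k) (simp_all add: bounded weighted_flow_bounded_sylvester)
    from weighted_flow_bounded_square_zero[OF this, of k] have "(sylvester A B ^^ m) x = 0"
      using Suc.prems Suc by simp
    then show ?thesis by (rule Suc.IH)
  qed (use Suc.prems in simp)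
qed (simp add: sylvester_def)

text \<open>Left multiplication by \<open>A\<close> and right multiplication by \<open>B\<close> commute, and they are nilpotent at \<open>V\<close>;
  so is their difference. The induction on \<open>p + q\<close> takes the place of the binomial theorem.\<close>
lemma sylvester_nilpotent:
  fixes A B V :: "'a::ring_1"
  assumes "A ^ p * V = 0" "V * B ^ q = 0"
  shows "(sylvester A B ^^ (p + q)) V = 0"
  using assms
proof (induction "p + q" arbitrary: p q V)
  case (Suc n)
  have diff: "(sylvester A B ^^ k) (x - y) = (sylvester A B ^^ k) x - (sylvester A B ^^ k) y" for k x y
    by (induction k) (simp_all add: sylvester_diff)
  show ?case
  proof (cases "p = 0 \<or> q = 0")
    case True
    then have "V = 0" using Suc.prems by auto
    then show ?thesis using diff[of _ 0 0] by simp
  next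
    case False
    then obtain p' q' where pq: "p = Suc p'" "q = Suc q'" by (metis not0_implies_Suc)
    have "(sylvester A B ^^ n) (A * V) = 0"
      using Suc.hyps(1)[of p' q "A * V"] Suc.hyps(2) Suc.prems pq
      by (simp add: power_commutes mult.assoc) (simp flip: mult.assoc power_commutes)
    moreover have "(sylvester A B ^^ n) (V * B) = 0"
      using Suc.hyps(1)[of p q' "V * B"] Suc.hyps(2) Suc.prems pq
      by (simp add: mult.assoc) (simp flip: mult.assoc)
    ultimately have "(sylvester A B ^^ n) (sylvester A B V) = 0"
      by (simp add: sylvester_def diff)
    then show ?thesis by (simp flip: Suc.hyps(2) funpow.simps(2) add: funpow_Suc_right del: funpow.simps)
  qed
qed auto

text \<open>In general the flow of such a \<open>V\<close> is the exponential \<open>exp((a - b)t)\<close> times a polynomial in \<open>t\<close>.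
  Boundedness for all times makes the polynomial constant.\<close>
lemma bounded_flow_of_generalized_eigenvectors:
  fixes A B V :: "'n::finite cmat"
  assumes left: "(A - scalar_mat a) ^ m * V = 0" and right: "V * (B - scalar_mat b) ^ m = 0"
    and bounded: "\<And>t. norm (flow A B V t) \<le> C"
  shows "flow A B V t = scalar_mat (exp ((a - b) * of_real t)) * V"
proof -
  let ?A = "A - scalar_mat a" and ?B = "B - scalar_mat b"
  have exp_shift: "exp (t *\<^sub>R (D + scalar_mat z)) =
      scalar_mat (exp (z * of_real t)) * exp (t *\<^sub>R D)" for D :: "'n cmat" and z t
  proof -
    have "t *\<^sub>R (D + scalar_mat z) = scalar_mat (z * of_real t) + t *\<^sub>R D"
      by (simp add: scaleR_eq_scalar_mat distrib_left scalar_mat_mult[symmetric] mult.commute add.commute)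
    moreover have "scalar_mat (z * of_real t) * (t *\<^sub>R D) = t *\<^sub>R D * scalar_mat (z * of_real t)"
      by (simp only: scalar_mat_commute)
    ultimately show ?thesis by (simp only: exp_add_commuting exp_scalar_mat)
  qed
  have flow_shift: "flow ?A ?B V t = scalar_mat (exp (- (a - b) * of_real t)) * flow A B V t" for t
  proof -
    have "exp (t *\<^sub>R ?A) = scalar_mat (exp (- a * of_real t)) * exp (t *\<^sub>R A)"
      using exp_shift[of t A "- a"] by (simp add: scalar_mat_minus)
    moreover have "exp (t *\<^sub>R - ?B) = scalar_mat (exp (b * of_real t)) * exp (t *\<^sub>R - B)"
      using exp_shift[of t "- B" b] by (simp add: algebra_simps)
    ultimately have "flow ?A ?B V t = scalar_mat (exp (- a * of_real t)) * (exp (t *\<^sub>R A) * V *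
        (scalar_mat (exp (b * of_real t)) * exp (t *\<^sub>R - B)))"
      by (simp only: flow_def mult.assoc)
    also have "\<dots> = scalar_mat (exp (- a * of_real t) * exp (b * of_real t)) * flow A B V t"
      by (simp only: scalar_mat_commute_left[of "exp (t *\<^sub>R A)"] scalar_mat_commute_left[of V] scalar_mat_mult flow_def mult.assoc)
    also have "exp (- a * of_real t) * exp (b * of_real t) = exp (- (a - b) * of_real t)"
      unfolding exp_add[symmetric] by (simp add: left_diff_distrib)
    finally show ?thesis .
  qed
  obtain K where K: "K > 0" "\<And>z. norm (scalar_mat z :: 'n cmat) \<le> norm z * K"
    using bounded_linear.pos_bounded[OF bounded_linear_scalar_mat] by blast
  have "weighted_flow_bounded (Re (a - b)) ?A ?B V"
    unfolding weighted_flow_bounded_def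
  proof (intro exI allI)
    fix t
    have "norm (flow ?A ?B V t) \<le>
        norm (scalar_mat (exp (- (a - b) * of_real t)) :: 'n cmat) * norm (flow A B V t)"
      unfolding flow_shift by (rule norm_mult_ineq)
    also have "\<dots> \<le> norm (exp (- (a - b) * of_real t)) * K * C"
      by (intro mult_mono K bounded) (use K in auto)
    finally have "exp (Re (a - b) * t) * norm (flow ?A ?B V t)
        \<le> exp (Re (a - b) * t) * (exp (- (Re (a - b) * t)) * K * C)"
      by (intro mult_left_mono) (simp_all add: left_diff_distrib)
    then show "exp (Re (a - b) * t) * norm (flow ?A ?B V t) \<le> K * C"
      by (simp add: exp_minus_inverse flip: mult.assoc)
  qed
  then have "sylvester ?A ?B V = 0"
    using weighted_flow_bounded_nilpotent sylvester_nilpotent[OF left right] by blast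
  then have "scalar_mat (exp ((a - b) * of_real t)) * V =
      scalar_mat (exp ((a - b) * of_real t)) * (scalar_mat (exp (- (a - b) * of_real t)) *
          flow A B V t)"
    by (simp only: flow_eq_const flip: flow_shift)
  also have "\<dots> = flow A B V t"
    by (simp only: mult.assoc[symmetric] scalar_mat_mult[symmetric] mult_minus_left exp_minus_inverse
        scalar_mat_hom mult_1_left)
  finally show ?thesis by simp
qed

section \<open>Symmetric half-lattice shifts and Hilbert's Theorem 90\<close>

text \<open>Let \<open>F k = 2\<pi>i\<langle>k,\<omega>\<rangle>\<close>. A choice function gives a representative \<open>rep z = z + F (j z)\<close> of each class
  modulo \<open>F\<close> of the lattice. The average \<open>r z = (rep z + cnj (rep (cnj z))) / 2\<close> also depends only on the
  class of \<open>z\<close>, and it commutes with conjugation. It equals \<open>z + F (m z)\<close> with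
  \<open>m z = (j z - j (cnj z)) / 2\<close>. If \<open>cnj w = z + F k\<close>, then \<open>cnj (r w) = r z\<close>, which says that
  \<open>F (m w + m z) = F k\<close>. The proof carries out this computation with \<open>j\<close> in place of \<open>r\<close>, to stay inside
  the lattice, where \<open>F\<close> is injective.\<close>
lemma half_lattice_gauge:
  fixes \<omega> :: "real ^ 'd"
  assumes \<omega>: "rationally_independent \<omega>"
  obtains m :: "complex \<Rightarrow> real ^ 'd" where "\<And>z. 2 *\<^sub>R m z \<in> integer_lattice"
    "\<And>z w k. k \<in> integer_lattice \<Longrightarrow> cnj w - z = 2 * pi * \<i> * of_real (k \<bullet> \<omega>) \<Longrightarrow> m w + m z = k"
proof -
  define F :: "real ^ 'd \<Rightarrow> complex" where "F k = 2 * pi * \<i> * of_real (k \<bullet> \<omega>)" for k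
  have F_add: "F (k + l) = F k + F l" and F_cnj: "cnj (F k) = - F k" for k l
    by (simp_all add: F_def inner_add_left algebra_simps)
  have F_inj: "k = l" if "F k = F l" "k \<in> integer_lattice" "l \<in> integer_lattice" for k l
  proof -
    have "(k - l) \<bullet> \<omega> = 0" using that(1) by (simp add: F_def inner_diff_left)
    then show ?thesis using rationally_independentD[OF \<omega>, of "k - l"] that by auto
  qed
  define R where "R z = {z + F k | k. k \<in> integer_lattice}" for z
  have R_eq: "R (z + F k) = R z" if "k \<in> integer_lattice" for z k
  proof (intro equalityI subsetI)
    fix w assume "w \<in> R (z + F k)"
    then obtain l where "l \<in> integer_lattice" "w = z + F (k + l)" by (auto simp: R_def F_add)
    then show "w \<in> R z" using that by (auto simp: R_def)
  next
    fix w assume "w \<in> R z"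
    then obtain l where l: "l \<in> integer_lattice" "w = z + F l" by (auto simp: R_def)
    then have "w = (z + F k) + F (l - k)" using F_add[of "l - k" k] by simp
    then show "w \<in> R (z + F k)" using that l(1) unfolding R_def by blast
  qed
  define rep where "rep z = (SOME w. w \<in> R z)" for z
  have "rep z \<in> R z" for z
  proof -
    have "z + F 0 \<in> R z" unfolding R_def by blast
    then show ?thesis unfolding rep_def by (rule someI)
  qed
  then have "\<exists>k. k \<in> integer_lattice \<and> rep z = z + F k" for z by (auto simp: R_def)
  then obtain j where j: "\<And>z. j z \<in> integer_lattice" "\<And>z. rep z = z + F (j z)" by metis
  have j_shift: "k + j (z + F k) = j z" if "k \<in> integer_lattice" for z k
  proof (rule F_inj)
    have "rep (z + F k) = rep z" by (simp add: rep_def R_eq that)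
    then show "F (k + j (z + F k)) = F (j z)" by (simp add: j(2) F_add)
  qed (use j(1) that in auto)
  define m where "m z = (1 / 2) *\<^sub>R (j z - j (cnj z))" for z
  have "2 *\<^sub>R m z \<in> integer_lattice" for z using j(1) by (simp add: m_def integer_lattice_closed)
  moreover have "m w + m z = k" if k: "k \<in> integer_lattice"
      and "cnj w - z = 2 * pi * \<i> * of_real (k \<bullet> \<omega>)" for z w k
  proof -
    have 1: "cnj w = z + F k" using that(2) by (simp add: F_def algebra_simps)
    then have "w = cnj (z + F k)" by (metis complex_cnj_cnj)
    then have 2: "cnj z = w + F k" by (simp add: F_cnj)
    have "j z = k + j (cnj w)" "j w = k + j (cnj z)"
      using j_shift[OF k, of z] j_shift[OF k, of w] 1 2 by simp_all
    then have "(j w - j (cnj w)) + (j z - j (cnj z)) = k + k" by simp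
    then have "m w + m z = (1 / 2) *\<^sub>R (k + k)" by (simp only: m_def flip: scaleR_right_distrib)
    then show ?thesis by (simp flip: scaleR_2)
  qed
  ultimately show ?thesis using that by blast
qed

text \<open>For every complex \<open>s\<close> the matrix \<open>P = s + cnj s \<cdot> W\<close> satisfies \<open>mat_cnj P \<cdot> W = P\<close>. For \<open>s\<close> on the unit
  circle it is \<open>cnj s \<cdot> (W + s\<^sup>2)\<close>, which is invertible unless \<open>-s\<^sup>2\<close> is one of the finitely many
  eigenvalues of \<open>W\<close>.\<close>
lemma hilbert_90:
  fixes W :: "'n::finite cmat"
  assumes W: "W * mat_cnj W = 1"
  obtains P Q where "P * Q = 1" "Q * P = 1" "mat_cnj P * W = P"
proof -
  obtain S where S: "finite S" "\<And>z. z \<notin> S \<Longrightarrow> \<exists>R. (W - scalar_mat z) * R = 1"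
    using finite_spectrum[of W] by blast
  have "infinite (sphere (0::complex) 1)"
  proof
    assume "finite (sphere (0::complex) 1)"
    then have "sphere (0::complex) 1 = {} \<or> (\<exists>z. sphere (0::complex) 1 = {z})"
      by (subst (asm) connected_finite_iff_sing) (simp_all add: connected_sphere)
    moreover have "1 \<in> sphere (0::complex) 1" "-1 \<in> sphere (0::complex) 1" by simp_all
    ultimately show False by (metis empty_iff one_neq_neg_one singletonD)
  qed
  then obtain z where z: "norm z = 1" "z \<notin> S"
    using S(1) by (metis finite_subset mem_sphere_0 subsetI)
  then obtain R where R: "(W - scalar_mat z) * R = 1" using S(2) by blast
  define s where "s = csqrt (- z)"
  have s2: "s * s = - z" by (simp add: s_def flip: power2_eq_square)
  have "norm s ^ 2 = 1" using z(1) by (simp add: s2 power2_eq_square flip: norm_mult)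
  then have s: "s * cnj s = 1" by (simp add: complex_norm_square[symmetric])
  define P where "P = scalar_mat s + scalar_mat (cnj s) * W"
  have "P = scalar_mat (cnj s) * (W - scalar_mat z)"
  proof -
    have "cnj s * - z = s * (s * cnj s)" unfolding s2[symmetric] by (simp only: mult_ac)
    then have "scalar_mat (cnj s * - z) = (scalar_mat s :: 'n cmat)" by (simp add: s)
    then have "scalar_mat (cnj s) * scalar_mat z = (- scalar_mat s :: 'n cmat)"
      by (simp add: scalar_mat_minus flip: scalar_mat_mult) (metis minus_minus)
    then show ?thesis by (simp add: P_def right_diff_distrib)
  qed
  then have "P * (scalar_mat s * R) = scalar_mat (cnj s * s) * ((W - scalar_mat z) * R)"
    by (simp only: scalar_mat_commute_left[of "W - scalar_mat z"] mult.assoc scalar_mat_mult)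
  also have "cnj s * s = 1" using s by (simp only: mult.commute)
  finally have 1: "P * (scalar_mat s * R) = 1" using R by simp
  have "mat_cnj W * W = 1" using W by (rule iffD1[OF cmat_left_right_inverse])
  have "mat_cnj P * W = (scalar_mat (cnj s) + scalar_mat s * mat_cnj W) * W"
    by (simp add: P_def mat_cnj_add mat_cnj_mult mat_cnj_scalar_mat)
  also have "\<dots> = P"
    using \<open>mat_cnj W * W = 1\<close> by (simp add: P_def distrib_right mult.assoc)
  finally show ?thesis using that 1 cmat_left_right_inverse by blast
qed

section \<open>Passing from a complex to a real Floquet form\<close>

text \<open>The identity \<open>g y - g x = g y (f x - f y) g x\<close> first bounds \<open>g y\<close> by \<open>2 \<parallel>g x\<parallel>\<close> for \<open>y\<close> near \<open>x\<close> and
  then shows that the difference is small.\<close>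
lemma continuous_on_algebra_inverse:
  fixes f g :: "'a::metric_space \<Rightarrow> 'b::real_normed_algebra_1"
  assumes f: "continuous_on S f" and inv: "\<And>x. x \<in> S \<Longrightarrow> f x * g x = 1" "\<And>x. x \<in> S \<Longrightarrow> g x * f x = 1"
  shows "continuous_on S g"
  unfolding continuous_on_iff
proof (intro ballI allI impI)
  fix x and e :: real assume x: "x \<in> S" and "0 < e"
  define K where "K = norm (g x)"
  have "K > 0" using inv(1)[OF x] by (auto simp: K_def)
  define r where "r = min (1 / (2 * K)) (e / (2 * K * K))"
  have "r > 0" using \<open>K > 0\<close> \<open>0 < e\<close> by (simp add: r_def)
  then obtain d where d: "d > 0" "\<And>y. y \<in> S \<Longrightarrow> dist y x < d \<Longrightarrow> dist (f y) (f x) < r"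
    using f x unfolding continuous_on_iff by metis
  have "dist (g y) (g x) < e" if y: "y \<in> S" "dist y x < d" for y
  proof -
    have close: "norm (f x - f y) < r" using d(2)[OF y] by (simp add: dist_norm norm_minus_commute)
    have "g y * (f x - f y) * g x = g y * (f x * g x) - (g y * f y) * g x" by (simp add: algebra_simps)
    then have diff: "g y - g x = g y * (f x - f y) * g x" using inv x y(1) by simp
    have bound: "norm (g y - g x) \<le> norm (g y) * norm (f x - f y) * K"
      unfolding diff K_def by (meson mult_right_mono norm_ge_zero norm_mult_ineq order_trans)
    also have "\<dots> \<le> norm (g y) * (1 / (2 * K)) * K"
      using close \<open>K > 0\<close> by (intro mult_right_mono mult_left_mono) (auto simp: r_def)
    also have "\<dots> = norm (g y) / 2" using \<open>K > 0\<close> by simp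
    finally have "norm (g y) \<le> 2 * K" using norm_triangle_sub[of "g y" "g x"] by (simp add: K_def)
    have "norm (g y) > 0" using inv(1)[OF y(1)] by auto
    have "norm (g y) * norm (f x - f y) * K < norm (g y) * r * K"
      using close \<open>K > 0\<close> \<open>norm (g y) > 0\<close> by simp
    also have "\<dots> \<le> 2 * K * (e / (2 * K * K)) * K"
      using \<open>norm (g y) \<le> 2 * K\<close> \<open>K > 0\<close> \<open>r > 0\<close> \<open>0 < e\<close> by (intro mult_mono) (auto simp: r_def)
    also have "\<dots> = e" using \<open>K > 0\<close> by simp
    finally show ?thesis using bound by (simp add: dist_norm)
  qed
  with d(1) show "\<exists>d>0. \<forall>y\<in>S. dist y x < d \<longrightarrow> dist (g y) (g x) < e" by blast
qed

text \<open>The whole argument, in the algebra \<open>cmat\<close>: \<open>Zi\<close> is the inverse of \<open>Z\<close>, and the assumption \<open>real\<close>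
  says that the cocycle is real.\<close>
lemma real_floquet_form:
  fixes \<omega> :: "real ^ 'd" and Z Zi :: "real ^ 'd \<Rightarrow> 'n::finite cmat" and B :: "'n cmat"
  assumes \<omega>: "rationally_independent \<omega>"
    and inv: "\<And>\<theta>. Z \<theta> * Zi \<theta> = 1" "\<And>\<theta>. Zi \<theta> * Z \<theta> = 1"
    and contZ: "continuous_on UNIV Z" and perZ: "torus_function 1 Z"
    and real: "\<And>t \<theta>. mat_cnj (Zi (\<theta> + t *\<^sub>R \<omega>) * exp (t *\<^sub>R B) * Z \<theta>) =
        Zi (\<theta> + t *\<^sub>R \<omega>) * exp (t *\<^sub>R B) * Z \<theta>"
  obtains Z' Zi' B' where "\<And>\<theta>. Z' \<theta> * Zi' \<theta> = 1" "\<And>\<theta>. Zi' \<theta> * Z' \<theta> = 1"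
    "continuous_on UNIV Z'" "torus_function 2 Z'" "\<And>\<theta>. mat_cnj (Z' \<theta>) = Z' \<theta>"
    "\<And>t \<theta>. Zi (\<theta> + t *\<^sub>R \<omega>) * exp (t *\<^sub>R B) * Z \<theta> = Zi' (\<theta> + t *\<^sub>R \<omega>) * exp (t *\<^sub>R B') * Z' \<theta>"
proof -
  have contZi: "continuous_on UNIV Zi"
    by (rule continuous_on_algebra_inverse[OF contZ]) (simp_all add: inv)
  have perZi: "Zi (\<theta> + k) = Zi \<theta>" if "k \<in> integer_lattice" for \<theta> k
  proof -
    have "Zi (\<theta> + k) = Zi (\<theta> + k) * (Z \<theta> * Zi \<theta>)" by (simp add: inv)
    also have "\<dots> = Zi (\<theta> + k) * Z (\<theta> + k) * Zi \<theta>"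
      by (simp add: periodicD(1)[OF perZ that] mult.assoc)
    finally show ?thesis by (simp add: inv)
  qed
  \<comment> \<open>\<open>W\<close> is the failure of \<open>Z\<close> to be real; reality of the cocycle makes it an orbit of a Sylvester flow.\<close>
  define W where "W \<theta> = mat_cnj (Z \<theta>) * Zi \<theta>" for \<theta>
  have WZ: "W \<theta> * Z \<theta> = mat_cnj (Z \<theta>)" for \<theta> by (simp add: W_def mult.assoc inv)
  have contW: "continuous_on UNIV W"
    unfolding W_def
    by (intro continuous_on_mult contZi bounded_linear.continuous_on[OF bounded_linear_mat_cnj] contZ)
  have perW: "torus_function 1 W"
    using perZ perZi by (simp add: torus_function_def W_def)
  have W_conj: "W \<theta> * mat_cnj (W \<theta>) = 1" for \<theta>
  proof -
    have "W \<theta> * mat_cnj (W \<theta>) = mat_cnj (Z \<theta>) * (Zi \<theta> * Z \<theta>) * mat_cnj (Zi \<theta>)"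
      by (simp add: W_def mat_cnj_mult mult.assoc)
    then show ?thesis by (simp add: inv flip: mat_cnj_mult)
  qed
  have W_flow: "flow (mat_cnj B) B (W \<theta>) t = W (\<theta> + t *\<^sub>R \<omega>)" for \<theta> t
  proof -
    let ?s = "\<theta> + t *\<^sub>R \<omega>"
    have "mat_cnj (Z ?s) * (mat_cnj (Zi ?s) * exp (t *\<^sub>R mat_cnj B) * mat_cnj (Z \<theta>)) * Zi \<theta> *
        exp (t *\<^sub>R - B) =
        mat_cnj (Z ?s) * (Zi ?s * exp (t *\<^sub>R B) * Z \<theta>) * Zi \<theta> * exp (t *\<^sub>R - B)"
      using real[of \<theta> t] by (simp add: mat_cnj_mult mat_cnj_exp mat_cnj_scaleR)
    moreover have "mat_cnj (Z ?s) * (mat_cnj (Zi ?s) * exp (t *\<^sub>R mat_cnj B) * mat_cnj (Z \<theta>)) *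
        Zi \<theta> * exp (t *\<^sub>R - B) =
        mat_cnj (Z ?s * Zi ?s) * flow (mat_cnj B) B (W \<theta>) t"
      by (simp add: mat_cnj_mult W_def flow_def mult.assoc)
    moreover have "mat_cnj (Z ?s) * (Zi ?s * exp (t *\<^sub>R B) * Z \<theta>) * Zi \<theta> * exp (t *\<^sub>R - B) =
        W ?s * (exp (t *\<^sub>R B) * (Z \<theta> * Zi \<theta>) * exp (t *\<^sub>R - B))"
      by (simp only: W_def mult.assoc)
    ultimately show ?thesis by (simp add: inv exp_minus_inverse)
  qed
  obtain S P N where S: "finite S" and P_sum: "(\<Sum>z\<in>S. P z) = 1"
    and P_comm: "\<And>z. z \<in> S \<Longrightarrow> B * P z = P z * B"
    and P_nil: "\<And>z. z \<in> S \<Longrightarrow> (B - scalar_mat z) ^ N * P z = 0"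
    and P_orth: "\<And>z w. z \<in> S \<Longrightarrow> w \<in> S \<Longrightarrow> P z * P w = (if z = w then P z else 0)"
    using spectral_projections[of B] by metis
  obtain m :: "complex \<Rightarrow> real ^ 'd" where m_half: "\<And>z. 2 *\<^sub>R m z \<in> integer_lattice"
    and m_res: "\<And>z w k. k \<in> integer_lattice \<Longrightarrow> cnj w - z = 2 * pi * \<i> * of_real (k \<bullet> \<omega>) \<Longrightarrow> m w + m z = k"
    using half_lattice_gauge[OF \<omega>] by blast
  \<comment> \<open>Each block is a constant times one character. If the block is not zero, its frequency \<open>k\<close> is the
      resonance between \<open>cnj w\<close> and \<open>z\<close>, and this is the vector \<open>m w + m z\<close>.\<close>
  have block: "mat_cnj (P w) * W \<theta> * P z =
      scalar_mat (character (m w + m z) \<theta>) * (mat_cnj (P w) * W 0 * P z)"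
    if zw: "z \<in> S" "w \<in> S" for z w \<theta>
  proof -
    define V where "V \<theta> = mat_cnj (P w) * W \<theta> * P z" for \<theta>
    have contV: "continuous_on UNIV V" unfolding V_def by (intro continuous_intros contW)
    have perV: "torus_function 1 V" using perW by (simp add: torus_function_def V_def)
    have V_flow: "flow (mat_cnj B) B (V \<theta>) t = V (\<theta> + t *\<^sub>R \<omega>)" for \<theta> t
    proof -
      have "mat_cnj B * mat_cnj (P w) = mat_cnj (P w) * mat_cnj B" using P_comm[OF zw(2)]
        by (metis mat_cnj_mult)
      then have 1: "exp (t *\<^sub>R mat_cnj B) * mat_cnj (P w) = mat_cnj (P w) * exp (t *\<^sub>R mat_cnj B)"
        by (intro exp_commutes_of_commutes) simp
      have 2: "exp (t *\<^sub>R - B) * P z = P z * exp (t *\<^sub>R - B)"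
        using P_comm[OF zw(1)] by (intro exp_commutes_of_commutes) simp
      have "flow (mat_cnj B) B (V \<theta>) t =
          (exp (t *\<^sub>R mat_cnj B) * mat_cnj (P w)) * W \<theta> * (P z * exp (t *\<^sub>R - B))"
        by (simp only: flow_def V_def mult.assoc)
      also have "\<dots> = mat_cnj (P w) * flow (mat_cnj B) B (W \<theta>) t * P z"
        unfolding 1 2[symmetric] by (simp only: flow_def mult.assoc)
      finally show ?thesis by (simp only: W_flow V_def)
    qed
    obtain D where D: "\<And>\<theta>. norm (V \<theta>) \<le> D" using periodic_bounded[OF contV perV] by blast
    \<comment> \<open>\<open>V\<close> lies in generalized eigenspaces from both sides, for \<open>cnj w\<close> from the left and for \<open>z\<close> from
        the right.\<close>
    have V_shift: "V (\<theta> + t *\<^sub>R \<omega>) = scalar_mat (exp ((cnj w - z) * of_real t)) * V \<theta>" for \<theta> t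
    proof -
      have "(mat_cnj B - scalar_mat (cnj w)) ^ N * mat_cnj (P w) =
          mat_cnj ((B - scalar_mat w) ^ N * P w)"
        by (simp add: mat_cnj_mult mat_cnj_power mat_cnj_diff mat_cnj_scalar_mat)
      then have "(mat_cnj B - scalar_mat (cnj w)) ^ N * V \<theta> = 0"
        using P_nil[OF zw(2)] by (simp add: V_def flip: mult.assoc)
      moreover have "P z * (B - scalar_mat z) ^ N = (B - scalar_mat z) ^ N * P z"
        by (intro power_commuting_commutes[symmetric] shift_commute P_comm zw)
      then have "V \<theta> * (B - scalar_mat z) ^ N = 0"
        using P_nil[OF zw(1)] by (simp add: V_def mult.assoc)
      ultimately show ?thesis
        using bounded_flow_of_generalized_eigenvectors[of "mat_cnj B" "cnj w" N "V \<theta>" B z D] D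
        by (simp add: V_flow)
    qed
    have "mat_of (V \<theta>) $ i $ j = character (m w + m z) \<theta> * mat_of (V 0) $ i $ j" for i j
    proof (cases "\<forall>\<theta>. mat_of (V \<theta>) $ i $ j = 0")
      case False
      then obtain \<theta>\<^sub>0 where nz: "mat_of (V \<theta>\<^sub>0) $ i $ j \<noteq> 0" by blast
      let ?f = "\<lambda>\<theta>. mat_of (V \<theta>) $ i $ j"
      have contf: "continuous_on UNIV ?f"
        by (intro continuous_intros bounded_linear.continuous_on[OF bounded_linear_mat_of] contV)
      have perf: "torus_function 1 ?f" using perV by (simp add: torus_function_def)
      have eigen: "?f (\<theta> + t *\<^sub>R \<omega>) = exp ((cnj w - z) * of_real t) * ?f \<theta>" for \<theta> t
        unfolding V_shift by (rule mat_of_scalar_mat_mult)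
      obtain k where k: "k \<in> integer_lattice" "cnj w - z = 2 * pi * \<i> * of_real (k \<bullet> \<omega>)"
        "\<And>\<theta>. ?f \<theta> = character k \<theta> * ?f 0"
        by (rule line_eigenfunction[OF \<omega> contf perf eigen nz]) (rule that)
      have "m w + m z = k" by (rule m_res[OF k(1,2)])
      then show ?thesis by (simp only: k(3)[of \<theta>])
    qed simp
    then have "mat_of (V \<theta>) = mat_of (scalar_mat (character (m w + m z) \<theta>) * V 0)"
      by (simp add: vec_eq_iff mat_of_scalar_mat_mult)
    then show ?thesis by (simp add: mat_of_inject V_def)
  qed
  \<comment> \<open>The gauge transformation that cancels the characters of all blocks at once: \<open>cnj (character (m w))\<close>
      acts from the left on the block of \<open>w\<close> and \<open>z\<close> and leaves \<open>character (m z)\<close>, which is \<open>\<Phi>\<close> on the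
      right.\<close>
  define \<Phi> where "\<Phi> \<theta> = (\<Sum>z\<in>S. scalar_mat (character (m z) \<theta>) * P z)" for \<theta>
  have diag_mult: "(\<Sum>z\<in>S. scalar_mat (f z) * P z) * (\<Sum>z\<in>S. scalar_mat (g z) * P z) =
      (\<Sum>z\<in>S. scalar_mat (f z * g z) * P z)"
    for f g :: "complex \<Rightarrow> complex"
  proof -
    have "(\<Sum>z\<in>S. scalar_mat (f z) * P z) * (\<Sum>z\<in>S. scalar_mat (g z) * P z) =
        (\<Sum>z\<in>S. \<Sum>w\<in>S. scalar_mat (f z) * (scalar_mat (g w) * (P z * P w)))"
      unfolding sum_product
      by (intro sum.cong refl) (simp only: mult.assoc scalar_mat_commute_left[of "P _"])
    also have "\<dots> = (\<Sum>z\<in>S. \<Sum>w\<in>S. if z = w then scalar_mat (f z) * (scalar_mat (g w) * P z) else 0)"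
      by (intro sum.cong refl) (simp add: P_orth)
    also have "\<dots> = (\<Sum>z\<in>S. scalar_mat (f z * g z) * P z)"
      using S by (simp add: scalar_mat_mult mult.assoc)
    finally show ?thesis .
  qed
  have \<Phi>_mult: "\<Phi> \<theta> * \<Phi> s = \<Phi> (\<theta> + s)" for \<theta> s
    by (simp only: \<Phi>_def diag_mult character_add)
  have \<Phi>_zero: "\<Phi> 0 = 1" by (simp add: \<Phi>_def P_sum)
  have \<Phi>_inv: "\<Phi> \<theta> * \<Phi> (- \<theta>) = 1" "\<Phi> (- \<theta>) * \<Phi> \<theta> = 1" for \<theta>
    by (simp_all add: \<Phi>_mult \<Phi>_zero)
  have \<Phi>_B: "exp (t *\<^sub>R B) * \<Phi> \<theta> = \<Phi> \<theta> * exp (t *\<^sub>R B)" for t \<theta>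
  proof (rule exp_commutes_of_commutes)
    have "B * \<Phi> \<theta> = \<Phi> \<theta> * B"
      by (simp add: \<Phi>_def sum_distrib_left sum_distrib_right scalar_mat_commute_left[of B] P_comm mult.assoc)
    then show "t *\<^sub>R B * \<Phi> \<theta> = \<Phi> \<theta> * t *\<^sub>R B" by simp
  qed
  have \<Phi>_W: "mat_cnj (\<Phi> \<theta>) * W \<theta> = W 0 * \<Phi> \<theta>" for \<theta>
  proof -
    have "mat_cnj (\<Phi> \<theta>) * W \<theta> =
        (\<Sum>w\<in>S. scalar_mat (cnj (character (m w) \<theta>)) * mat_cnj (P w)) * W \<theta> * (\<Sum>z\<in>S. P z)"
      by (simp only: \<Phi>_def P_sum mult_1_right mat_cnj_sum mat_cnj_mult mat_cnj_scalar_mat)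
    also have "\<dots> = (\<Sum>w\<in>S. \<Sum>z\<in>S. scalar_mat (cnj (character (m w) \<theta>)) * (mat_cnj (P w) * W \<theta> * P z))"
      by (simp only: sum_distrib_right[of _ S "W \<theta>"] sum_product mult.assoc)
    also have "\<dots> = (\<Sum>w\<in>S. \<Sum>z\<in>S. mat_cnj (P w) * (W 0 * (scalar_mat (character (m z) \<theta>) * P z)))"
    proof (intro sum.cong refl)
      fix w z assume wz: "w \<in> S" "z \<in> S"
      let ?c = "\<lambda>z. character (m z) \<theta>" and ?V = "mat_cnj (P w) * W 0 * P z"
      have "scalar_mat (cnj (?c w)) * (mat_cnj (P w) * W \<theta> * P z) =
          scalar_mat (cnj (?c w)) * (scalar_mat (?c w * ?c z) * ?V)"
        by (simp only: block[OF wz(2,1), of \<theta>] character_add_left)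
      also have "\<dots> = scalar_mat (cnj (?c w) * ?c w * ?c z) * ?V"
        by (simp only: scalar_mat_mult mult.assoc)
      also have "\<dots> = scalar_mat (?c z) * ?V" by (simp only: cnj_character mult_1_left)
      also have "\<dots> = mat_cnj (P w) * (W 0 * (scalar_mat (?c z) * P z))"
        by (simp only: scalar_mat_commute_left[of "W 0"] scalar_mat_commute_left[of "mat_cnj (P w)"] mult.assoc)
      finally show "scalar_mat (cnj (?c w)) * (mat_cnj (P w) * W \<theta> * P z) =
          mat_cnj (P w) * (W 0 * (scalar_mat (?c z) * P z))" .
    qed
    also have "\<dots> = mat_cnj (\<Sum>w\<in>S. P w) * (W 0 * \<Phi> \<theta>)"
      unfolding \<Phi>_def mat_cnj_sum sum_distrib_left[of "W 0"] sum_product ..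
    finally show ?thesis by (simp add: P_sum)
  qed
  \<comment> \<open>The constant \<open>W 0\<close> is what separates \<open>\<Phi> Z\<close> from its conjugate.\<close>
  obtain R Q where RQ: "R * Q = 1" "Q * R = 1" and R: "mat_cnj R * W 0 = R"
    using hilbert_90[OF W_conj] by blast
  define Z' where "Z' \<theta> = R * \<Phi> \<theta> * Z \<theta>" for \<theta>
  define Zi' where "Zi' \<theta> = Zi \<theta> * \<Phi> (- \<theta>) * Q" for \<theta>
  define D where "D = (\<Sum>z\<in>S. scalar_mat (2 * pi * \<i> * of_real (m z \<bullet> \<omega>)) * P z)"
  define B' where "B' = R * (B + D) * Q"
  have exp_D: "exp (t *\<^sub>R D) = \<Phi> (t *\<^sub>R \<omega>)" for t
  proof -
    define c where "c z = 2 * pi * \<i> * of_real (m z \<bullet> \<omega>) * of_real t" for z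
    have tD: "t *\<^sub>R D = (\<Sum>z\<in>S. scalar_mat (c z) * P z)"
      unfolding D_def scaleR_sum_right
      by (intro sum.cong refl) (simp only: scaleR_eq_scalar_mat c_def mult.assoc[symmetric] scalar_mat_mult[symmetric],
        simp only: mult_ac)
    have pow: "(t *\<^sub>R D) ^ n = (\<Sum>z\<in>S. scalar_mat (c z ^ n) * P z)" for n
    proof (induction n)
      case (Suc n)
      have "(t *\<^sub>R D) ^ Suc n = (\<Sum>z\<in>S. scalar_mat (c z) * P z) * (\<Sum>z\<in>S. scalar_mat (c z ^ n) * P z)"
        by (simp only: power_Suc Suc.IH) (simp only: tD)
      then show ?case by (simp only: diag_mult power_Suc)
    qed (simp add: P_sum)
    have "(\<lambda>n. \<Sum>z\<in>S. scalar_mat (c z ^ n /\<^sub>R fact n) * P z) sums (\<Sum>z\<in>S. scalar_mat (exp (c z)) * P z)"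
      by (intro sums_sum bounded_linear.sums[OF bounded_linear_mult_left]
          bounded_linear.sums[OF bounded_linear_scalar_mat] exp_converges)
    moreover have "(\<Sum>z\<in>S. scalar_mat (c z ^ n /\<^sub>R fact n) * P z) = (t *\<^sub>R D) ^ n /\<^sub>R fact n" for n
      by (simp add: pow scaleR_sum_right linear_cmul[OF bounded_linear.linear[OF bounded_linear_scalar_mat]]
          del: scaleR_power)
    ultimately have "(\<lambda>n. (t *\<^sub>R D) ^ n /\<^sub>R fact n) sums (\<Sum>z\<in>S. scalar_mat (exp (c z)) * P z)" by simp
    then have "exp (t *\<^sub>R D) = (\<Sum>z\<in>S. scalar_mat (exp (c z)) * P z)"
      using exp_converges sums_unique2 by blast
    then show ?thesis by (simp add: \<Phi>_def character_scaleR c_def)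
  qed
  have exp_B': "exp (t *\<^sub>R B') = R * (exp (t *\<^sub>R B) * \<Phi> (t *\<^sub>R \<omega>)) * Q" for t
  proof -
    have "B * D = D * B"
      by (simp add: D_def sum_distrib_left sum_distrib_right scalar_mat_commute_left[of B] P_comm mult.assoc)
    then have "exp (t *\<^sub>R B + t *\<^sub>R D) = exp (t *\<^sub>R B) * exp (t *\<^sub>R D)"
      by (intro exp_add_commuting) simp
    then have "exp (R * (t *\<^sub>R B + t *\<^sub>R D) * Q) = R * (exp (t *\<^sub>R B) * \<Phi> (t *\<^sub>R \<omega>)) * Q"
      by (simp only: exp_similarity[OF RQ] exp_D)
    then show ?thesis by (simp add: B'_def flip: scaleR_right_distrib)
  qed
  show ?thesis
  proof (rule that[of Z' Zi' B'])
    fix \<theta>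
    have "Z' \<theta> * Zi' \<theta> = R * (\<Phi> \<theta> * (Z \<theta> * Zi \<theta>) * \<Phi> (- \<theta>)) * Q"
      by (simp only: Z'_def Zi'_def mult.assoc)
    then show "Z' \<theta> * Zi' \<theta> = 1" by (simp add: inv \<Phi>_inv RQ)
    then show "Zi' \<theta> * Z' \<theta> = 1" by (rule iffD1[OF cmat_left_right_inverse])
    have "mat_cnj (Z' \<theta>) = mat_cnj R * (mat_cnj (\<Phi> \<theta>) * W \<theta>) * Z \<theta>"
      by (simp only: Z'_def mat_cnj_mult mult.assoc WZ)
    also have "\<dots> = (mat_cnj R * W 0) * \<Phi> \<theta> * Z \<theta>" by (simp only: \<Phi>_W mult.assoc)
    finally show "mat_cnj (Z' \<theta>) = Z' \<theta>" by (simp only: R Z'_def)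
    fix t
    let ?s = "\<theta> + t *\<^sub>R \<omega>"
    have "Zi' ?s * exp (t *\<^sub>R B') * Z' \<theta> =
        Zi ?s * \<Phi> (- ?s) * (Q * R) * exp (t *\<^sub>R B) * \<Phi> (t *\<^sub>R \<omega>) * (Q * R) * \<Phi> \<theta> * Z \<theta>"
      by (simp only: Zi'_def Z'_def exp_B' mult.assoc)
    also have "\<dots> = Zi ?s * \<Phi> (- ?s) * exp (t *\<^sub>R B) * (\<Phi> (t *\<^sub>R \<omega>) * \<Phi> \<theta>) * Z \<theta>"
      by (simp only: RQ mult_1_right mult.assoc)
    also have "\<dots> = Zi ?s * \<Phi> (- ?s) * (exp (t *\<^sub>R B) * \<Phi> ?s) * Z \<theta>"
      by (simp only: \<Phi>_mult add.commute mult.assoc)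
    also have "\<dots> = Zi ?s * (\<Phi> (- ?s) * \<Phi> ?s) * exp (t *\<^sub>R B) * Z \<theta>"
      by (simp only: \<Phi>_B mult.assoc)
    finally show "Zi ?s * exp (t *\<^sub>R B) * Z \<theta> = Zi' ?s * exp (t *\<^sub>R B') * Z' \<theta>"
      by (simp only: \<Phi>_inv mult_1_right)
  next
    show "continuous_on UNIV Z'"
      unfolding Z'_def \<Phi>_def
      by (intro continuous_intros contZ bounded_linear.continuous_on[OF bounded_linear_scalar_mat] continuous_on_character)
    show "torus_function 2 Z'"
      unfolding torus_function_def
    proof (intro ballI allI)
      fix k \<theta> :: "real ^ 'd" assume k: "k \<in> integer_lattice"
      have "\<Phi> (\<theta> + 2 *\<^sub>R k) = \<Phi> \<theta>"
        by (simp add: \<Phi>_def character_add character_half_lattice_periodic[OF m_half k])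
      moreover have "2 *\<^sub>R k \<in> integer_lattice" using integer_lattice_closed(2)[OF k k]
        by (simp only: scaleR_2)
      ultimately show "Z' (\<theta> + real 2 *\<^sub>R k) = Z' \<theta>"
        using periodicD(1)[OF perZ] by (simp add: Z'_def)
    qed
  qed
qed

lemma GL_complex_iff: "mat_of A \<in> GL_complex \<longleftrightarrow> (\<exists>B. A * B = 1 \<and> B * A = 1)"
proof -
  have "(\<exists>B. A * B = 1 \<and> B * A = 1) \<longleftrightarrow> (\<exists>B. mat_of A ** B = mat 1 \<and> B ** mat_of A = mat 1)"
    by transfer simp
  then show ?thesis by (simp add: GL_complex_def invertible_def)
qed

lemma GL_real_iff: "mat_of A \<in> GL_real \<longleftrightarrow> mat_of A \<in> GL_complex \<and> mat_cnj A = A"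
proof -
  have "mat_cnj A = A \<longleftrightarrow> (\<forall>i j. mat_of A $ i $ j \<in> \<real>)"
    by (simp add: mat_of_inject[symmetric] mat_cnj.rep_eq vec_eq_iff Reals_cnj_iff)
  then show ?thesis by (simp add: GL_real_def GL_complex_def)
qed

lemma matrix_inv_mat_of:
  assumes "A * B = 1"
  shows "matrix_inv (mat_of A) = mat_of B"
proof -
  have BA: "B * A = 1" using assms by (rule iffD1[OF cmat_left_right_inverse])
  have "mat_of A ** mat_of B = mat 1 \<and> mat_of B ** mat_of A = mat 1"
    using assms BA by (simp flip: times_cmat.rep_eq one_cmat.rep_eq)
  then have "mat_of A ** matrix_inv (mat_of A) = mat 1"
    unfolding matrix_inv_def by (rule someI2) simp
  then have "mat_of B ** (mat_of A ** matrix_inv (mat_of A)) = mat_of B" by simp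
  then show ?thesis
    using BA by (simp add: matrix_mul_assoc flip: times_cmat.rep_eq) (simp add: one_cmat.rep_eq)
qed

lemma matrix_exp_mat_of: "matrix_exp (t *\<^sub>R mat_of B) = mat_of (exp (t *\<^sub>R B))"
  by (simp add: matrix_exp_eq_exp mat_of_inverse flip: scaleR_cmat.rep_eq)

lemma mat_cnj_inverse:
  assumes "A * B = 1" "mat_cnj A = A"
  shows "mat_cnj B = B"
proof -
  have "A * mat_cnj B = 1" using assms by (metis mat_cnj_1 mat_cnj_mult)
  moreover have "B * A = 1" using assms(1) cmat_left_right_inverse by blast
  ultimately show ?thesis by (metis mult.assoc mult_1_left mult_1_right)
qed

theorem theorem1:
  fixes \<omega> :: "real ^ 'd"
    and X :: "real \<Rightarrow> real ^ 'd \<Rightarrow> complex ^ 'n ^ 'n"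
  assumes "rationally_independent \<omega>"
    and "continuous_cocycle \<omega> GL_real X"
    and "reducible \<omega> GL_complex X"
  shows "reducible_modulo \<omega> GL_real 2 X"
proof -
  obtain Y C where Y: "torus_function 1 Y" "continuous_on UNIV Y" "\<And>\<theta>. Y \<theta> \<in> GL_complex"
    and X: "\<And>t \<theta>. X t \<theta> = matrix_inv (Y (\<theta> + t *\<^sub>R \<omega>)) ** matrix_exp (t *\<^sub>R C) ** Y \<theta>"
    using assms(3) by (auto simp: reducible_modulo_def)
  define B where "B = cmat_of C"
  define Z where "Z \<theta> = cmat_of (Y \<theta>)" for \<theta>
  have Y_Z: "Y \<theta> = mat_of (Z \<theta>)" and C_B: "C = mat_of B" for \<theta>
    by (simp_all add: Z_def B_def cmat_of_inverse)
  obtain Zi where Zi: "\<And>\<theta>. Z \<theta> * Zi \<theta> = 1" "\<And>\<theta>. Zi \<theta> * Z \<theta> = 1"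
    using Y(3) unfolding Y_Z GL_complex_iff by metis
  have X_Z: "X t \<theta> = mat_of (Zi (\<theta> + t *\<^sub>R \<omega>) * exp (t *\<^sub>R B) * Z \<theta>)" for t \<theta>
    by (simp add: X Y_Z C_B matrix_inv_mat_of[OF Zi(1)] matrix_exp_mat_of times_cmat.rep_eq)
  have X_real: "X t \<theta> \<in> GL_real" for t \<theta>
    using assms(2) by (simp add: continuous_cocycle_def)
  have contZ: "continuous_on UNIV Z" and perZ: "torus_function 1 Z"
    unfolding Z_def using Y(1,2)
    by (auto intro: bounded_linear.continuous_on[OF bounded_linear_cmat_of] simp: torus_function_def)
  have realZ: "mat_cnj (Zi (\<theta> + t *\<^sub>R \<omega>) * exp (t *\<^sub>R B) * Z \<theta>) =
      Zi (\<theta> + t *\<^sub>R \<omega>) * exp (t *\<^sub>R B) * Z \<theta>" for t \<theta>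
    using X_real[of t \<theta>] unfolding X_Z GL_real_iff by blast
  obtain Z' Zi' B' where Z': "\<And>\<theta>. Z' \<theta> * Zi' \<theta> = 1" "\<And>\<theta>. Zi' \<theta> * Z' \<theta> = 1"
      "continuous_on UNIV Z'" "torus_function 2 Z'" "\<And>\<theta>. mat_cnj (Z' \<theta>) = Z' \<theta>"
    and eq: "\<And>t \<theta>. Zi (\<theta> + t *\<^sub>R \<omega>) * exp (t *\<^sub>R B) * Z \<theta> = Zi' (\<theta> + t *\<^sub>R \<omega>) * exp (t *\<^sub>R B') * Z' \<theta>"
    by (rule real_floquet_form[OF assms(1) Zi contZ perZ realZ]) (rule that)
  have X_Z': "X t \<theta> = matrix_inv (mat_of (Z' (\<theta> + t *\<^sub>R \<omega>))) ** matrix_exp (t *\<^sub>R mat_of B') ** mat_of (Z' \<theta>)" for t \<theta>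
    by (simp add: X_Z eq matrix_inv_mat_of[OF Z'(1)] matrix_exp_mat_of times_cmat.rep_eq)
  \<comment> \<open>Solving the new form of the cocycle at \<open>\<theta> = 0\<close> for \<open>exp(tB')\<close> expresses it by real matrices.\<close>
  have "mat_of B' \<in> lie_algebra GL_real"
    unfolding lie_algebra_def mem_Collect_eq
  proof
    fix t
    let ?s = "0 + t *\<^sub>R \<omega>" and ?E = "exp (t *\<^sub>R B')"
    have "mat_cnj (Zi' ?s * ?E * Z' 0) = Zi' ?s * ?E * Z' 0"
      using X_real[of t 0] unfolding X_Z eq GL_real_iff by blast
    then have "Z' ?s * (Zi' ?s * mat_cnj ?E * Z' 0) * Zi' 0 = Z' ?s * (Zi' ?s * ?E * Z' 0) * Zi' 0"
      using mat_cnj_inverse[OF Z'(1) Z'(5)] by (simp add: mat_cnj_mult Z'(5))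
    then have "(Z' ?s * Zi' ?s) * mat_cnj ?E * (Z' 0 * Zi' 0) = (Z' ?s * Zi' ?s) * ?E * (Z' 0 * Zi' 0)"
      by (simp only: mult.assoc)
    then have "mat_cnj ?E = ?E" by (simp only: Z'(1) mult_1_left mult_1_right)
    moreover have "mat_of ?E \<in> GL_complex"
      unfolding GL_complex_iff
        using exp_minus_inverse[of "t *\<^sub>R B'"] exp_minus_inverse[of "- (t *\<^sub>R B')"] by auto
    ultimately show "matrix_exp (t *\<^sub>R mat_of B') \<in> GL_real"
      by (simp add: matrix_exp_mat_of GL_real_iff)
  qed
  moreover have "torus_function 2 (\<lambda>\<theta>. mat_of (Z' \<theta>))" using Z'(4) by (simp add: torus_function_def)
  moreover have "continuous_on UNIV (\<lambda>\<theta>. mat_of (Z' \<theta>))"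
    by (intro bounded_linear.continuous_on[OF bounded_linear_mat_of] Z'(3))
  moreover have "mat_of (Z' \<theta>) \<in> GL_real" for \<theta>
    unfolding GL_real_iff GL_complex_iff using Z'(1,2,5) by blast
  ultimately show ?thesis
    unfolding reducible_modulo_def using X_Z' by blast
qed

end
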